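(* Let $M$ be a matroid without loops and coloops, and let $a$ be a real number with $a\geqslant 2.355$. Then $$T_M(a,0)\,T_M(0,a)\geqslant T_M(1,1)^2 .$$
   Context: Matroids are on finite ground sets. For a matroid $M$ with ground set $E$ and rank function $r$, the Tutte polynomial is $T_M(x,y)=\sum_{S\subseteq E}(x-1)^{r(E)-r(S)}(y-1)^{|S|-r(S)}$ (with the convention $0^0=1$). A loop of $M$ is an element $e\in E$ with $r(\{e\})=0$; a coloop of $M$ is a loop of the dual matroid $M^*$, equivalently an element contained in every basis of $M$. *)

theory Defs
  imports Complex_Main
begin

locale matroid =
  fixes E :: "'a set" and indep :: "'a set \<Rightarrow> bool"
  assumes finite_ground: "finite E"
    and indep_subset_ground: "indep I \<Longrightarrow> I \<subseteq> E"
    and indep_empty: "indep {}"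
    and indep_mono: "indep J \<Longrightarrow> I \<subseteq> J \<Longrightarrow> indep I"
    and indep_augment: "indep I \<Longrightarrow> indep J \<Longrightarrow> card I < card J \<Longrightarrow> \<exists>x\<in>J - I. indep (insert x I)"

definition matroid_rank :: "('a set \<Rightarrow> bool) \<Rightarrow> 'a set \<Rightarrow> nat" where
  "matroid_rank indep S = Max (card ` {I. I \<subseteq> S \<and> indep I})"

definition matroid_basis :: "('a set \<Rightarrow> bool) \<Rightarrow> 'a set \<Rightarrow> bool" where
  "matroid_basis indep B \<longleftrightarrow> indep B \<and> (\<forall>I. indep I \<and> B \<subseteq> I \<longrightarrow> I = B)"

text \<open>The bases of the dual matroid are the complements of bases, so its independent sets are
  the sets that avoid some basis.\<close>

definition dual_indep :: "'a set \<Rightarrow> ('a set \<Rightarrow> bool) \<Rightarrow> 'a set \<Rightarrow> bool" where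
  "dual_indep E indep X \<longleftrightarrow> X \<subseteq> E \<and> (\<exists>B. matroid_basis indep B \<and> X \<inter> B = {})"

definition matroid_loop :: "'a set \<Rightarrow> ('a set \<Rightarrow> bool) \<Rightarrow> 'a \<Rightarrow> bool" where
  "matroid_loop E indep e \<longleftrightarrow> e \<in> E \<and> matroid_rank indep {e} = 0"

definition matroid_coloop :: "'a set \<Rightarrow> ('a set \<Rightarrow> bool) \<Rightarrow> 'a \<Rightarrow> bool" where
  "matroid_coloop E indep e \<longleftrightarrow> matroid_loop E (dual_indep E indep) e"

text \<open>Both truncated subtractions are exact in a matroid, since the rank of \<open>S\<close> is at most
  \<open>card S\<close> and at most the rank of \<open>E\<close>; and \<open>0 ^ 0 = 1\<close> for natural exponents.\<close>

definition tutte :: "'a set \<Rightarrow> ('a set \<Rightarrow> bool) \<Rightarrow> real \<Rightarrow> real \<Rightarrow> real" where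
  "tutte E indep x y =
    (\<Sum>S\<in>Pow E. (x - 1) ^ (matroid_rank indep E - matroid_rank indep S)
                * (y - 1) ^ (card S - matroid_rank indep S))"

context matroid
begin

lemma indep_finite: "indep I \<Longrightarrow> finite I"
  using finite_ground indep_subset_ground finite_subset by blast

lemma indep_card_le: "indep I \<Longrightarrow> card I \<le> card E"
  using finite_ground indep_subset_ground card_mono by blast

lemma basis_card_max:
  assumes "matroid_basis indep B" "indep I"
  shows "card I \<le> card B"
proof (rule ccontr)
  assume "\<not> card I \<le> card B"
  then obtain x where "x \<in> I - B" "indep (insert x B)"
    using assms indep_augment unfolding matroid_basis_def by (meson not_le)
  then show False using assms unfolding matroid_basis_def by blast
qed

lemma basis_of_card_ge:
  assumes "matroid_basis indep B" "indep I" "card B \<le> card I"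
  shows "matroid_basis indep I"
  unfolding matroid_basis_def
proof (intro conjI allI impI)
  fix J assume J: "indep J \<and> I \<subseteq> J"
  then have "card J \<le> card I" using basis_card_max assms by fastforce
  then show "J = I" using card_seteq[OF indep_finite[of J], of I] J by blast
qed (use assms in auto)

lemma extend_within:
  assumes "indep I" "matroid_basis indep B"
  shows "\<exists>B'. matroid_basis indep B' \<and> I \<subseteq> B' \<and> B' \<subseteq> I \<union> B"
  using assms(1)
proof (induction "card B - card I" arbitrary: I rule: less_induct)
  case less
  show ?case
  proof (cases "card I < card B")
    case True
    then obtain x where x: "x \<in> B - I" "indep (insert x I)"
      using indep_augment less.prems assms(2) unfolding matroid_basis_def by blast
    have "card B - card (insert x I) < card B - card I"
      using True x indep_finite[OF less.prems] by simp
    from less.hyps[OF this x(2)] show ?thesis using x by auto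
  next
    case False
    then show ?thesis using basis_of_card_ge[OF assms(2) less.prems] by auto
  qed
qed

lemma basis_exists: "\<exists>B. matroid_basis indep B"
proof -
  have "\<exists>B. indep B \<and> (\<forall>I. indep I \<longrightarrow> card I \<le> card B)"
    by (rule ex_has_greatest_nat[where b = "Suc (card E)"])
      (use indep_empty indep_card_le in \<open>auto simp: less_Suc_eq_le\<close>)
  then obtain B where B: "indep B" "\<And>I. indep I \<Longrightarrow> card I \<le> card B" by blast
  have "matroid_basis indep B"
    unfolding matroid_basis_def
  proof (intro conjI allI impI)
    fix J assume J: "indep J \<and> B \<subseteq> J"
    then show "J = B" using card_seteq[OF indep_finite[of J], of B] B(2)[of J] by blast
  qed (rule B(1))
  then show ?thesis ..
qed

lemma matroid_dual: "matroid E (dual_indep E indep)"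
proof
  fix X Y
  assume "dual_indep E indep X" "dual_indep E indep Y" and lt: "card X < card Y"
  then obtain A B where A: "X \<subseteq> E" "matroid_basis indep A" "X \<inter> A = {}"
    and B: "Y \<subseteq> E" "matroid_basis indep B" "Y \<inter> B = {}"
    unfolding dual_indep_def by blast
  have iB: "indep (B - X)" using indep_mono[of B "B - X"] B(2) unfolding matroid_basis_def by auto
  from extend_within[OF iB A(2)] obtain C
    where C: "matroid_basis indep C" "B - X \<subseteq> C" "C \<subseteq> (B - X) \<union> A" by blast
  have fin: "finite X" "finite Y" "finite B" "finite C"
    using finite_subset[OF A(1) finite_ground] finite_subset[OF B(1) finite_ground]
      indep_finite B(2) C(1) unfolding matroid_basis_def by simp_all
  have "\<not> Y - X \<subseteq> C"
  proof
    assume sub: "Y - X \<subseteq> C"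
    have "card (B - X) + card (Y - X) = card ((B - X) \<union> (Y - X))"
      using B fin by (subst card_Un_disjoint) auto
    also have "\<dots> \<le> card C" using sub C fin by (intro card_mono) auto
    also have "\<dots> \<le> card B" using basis_card_max[OF B(2)] C(1) unfolding matroid_basis_def by simp
    also have "card B = card (B - X) + card (B \<inter> X)"
      using fin(3) card_Int_Diff[of B X] by simp
    also have "card (B \<inter> X) \<le> card (X - Y)" using B fin by (intro card_mono) auto
    finally have "card (Y - X) \<le> card (X - Y)" by simp
    moreover have "card X = card (X \<inter> Y) + card (X - Y)" "card Y = card (X \<inter> Y) + card (Y - X)"
      using fin card_Int_Diff[of X Y] card_Int_Diff[of Y X] by (simp_all add: Int_commute)
    ultimately show False using lt by simp
  qed
  then obtain y where y: "y \<in> Y - X" "y \<notin> C" by blast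
  then have "insert y X \<inter> C = {}" using A C by blast
  then show "\<exists>x\<in>Y - X. dual_indep E indep (insert x X)"
    using y A B C unfolding dual_indep_def by blast
qed (use finite_ground basis_exists in \<open>auto simp: dual_indep_def\<close>)

lemma loop_iff: "matroid_loop E indep e \<longleftrightarrow> e \<in> E \<and> \<not> indep {e}"
proof -
  have "{I. I \<subseteq> {e} \<and> indep I} = (if indep {e} then {{}, {e}} else {{}})"
    using indep_empty by (auto simp: subset_singleton_iff)
  then show ?thesis by (auto simp: matroid_loop_def matroid_rank_def)
qed

lemma coloop_iff:
  "matroid_coloop E indep e \<longleftrightarrow> e \<in> E \<and> (\<forall>B. matroid_basis indep B \<longrightarrow> e \<in> B)"
  using matroid.loop_iff[OF matroid_dual] by (auto simp: matroid_coloop_def dual_indep_def)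

end

end

theory Submission
  imports Defs "HOL-Library.FuncSet"
begin

text \<open>For every linear order of the ground set, \<open>T(x, y)\<close> is the sum over the bases \<open>B\<close> of
  \<open>x ^ i y ^ j\<close>, where \<open>i\<close> and \<open>j\<close> count the internally and externally active elements; an element
  is active if it exceeds all its neighbours in the bipartite exchange graph of \<open>B\<close>. Hence \<open>T(a, 0)\<close>
  and \<open>T(0, a)\<close> are also the averages of these sums over a random order, and by Cauchy-Schwarz it
  suffices that for each \<open>B\<close> the product of the two averages is at least 1.

  Take the order from independent uniform values in \<open>[0, 1]\<close>. On the side whose vertices must be
  inactive, only count the outcomes in which every vertex other than a leaf has a value below \<open>4/5\<close>.
  Group each vertex with the leaves attached to it. The contribution of a group is increasing in the
  values on one side and decreasing in those on the other, so Harris' inequality bounds each average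
  below by a product over the groups. Multiplying the two bounds leaves for each group a factor which
  depends only on its number of leaves and of other neighbours, and which exceeds 1 already for
  \<open>a = 7/3\<close>. To keep everything finite, the uniform values are replaced by a grid of \<open>5n\<close> points with
  \<open>n\<close> large; ties only weaken the bounds.\<close>

section \<open>Basis activities\<close>

text \<open>For a basis \<open>B\<close> these are the fundamental cocircuit of \<open>u\<close> (if
  \<open>u\<close> lies in \<open>B\<close>) and its fundamental circuit (if not), with
  \<open>u\<close> itself removed.\<close>

definition exch_nbrs :: "'a set \<Rightarrow> ('a set \<Rightarrow> bool) \<Rightarrow> 'a set \<Rightarrow> 'a \<Rightarrow> 'a set" where
  "exch_nbrs E indep B u =
    (if u \<in> B then {w \<in> E - B. matroid_basis indep (insert w (B - {u}))}
     else {v \<in> B. matroid_basis indep (insert u (B - {v}))})"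

text \<open>Activity by maximum instead of the customary minimum. The values \<open>t\<close> may
  have ties; an element tied with a neighbour is inactive.\<close>

definition active :: "'a set \<Rightarrow> ('a set \<Rightarrow> bool) \<Rightarrow> 'a set \<Rightarrow> ('a \<Rightarrow> 'b::linorder) \<Rightarrow> 'a set" where
  "active E indep B t = {u \<in> E. \<forall>w \<in> exch_nbrs E indep B u. t w < t u}"

context matroid
begin

section \<open>Exchange properties of bases\<close>

lemma basis_indep: "matroid_basis indep B \<Longrightarrow> indep B"
  by (simp add: matroid_basis_def)

lemma basis_subset: "matroid_basis indep B \<Longrightarrow> B \<subseteq> E"
  using basis_indep indep_subset_ground by blast

lemma basis_finite: "matroid_basis indep B \<Longrightarrow> finite B"
  using basis_indep indep_finite by blast

lemma basis_card_eq: "matroid_basis indep B \<Longrightarrow> matroid_basis indep B' \<Longrightarrow> card B = card B'"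
  using basis_card_max basis_indep by (simp add: le_antisym)

lemma finite_bases: "finite {B. matroid_basis indep B}"
  by (rule finite_subset[of _ "Pow E"]) (auto simp: finite_ground dest: basis_subset)

lemma basis_swap_indep:
  assumes B: "matroid_basis indep B" and e: "e \<in> B" and f: "f \<notin> B"
    and i: "indep (insert f (B - {e}))"
  shows "matroid_basis indep (insert f (B - {e}))"
proof (rule basis_of_card_ge[OF B i])
  show "card B \<le> card (insert f (B - {e}))"
    using basis_finite[OF B] e f by (simp add: card.remove[of B e] del: card_Diff_insert card_Diff_singleton)
qed

text \<open>If this set were independent, it would extend to a basis inside
  \<open>insert e B\<close>. That basis misses some \<open>g\<close> of \<open>B\<close>, so by
  cardinality it is \<open>insert e (B - {g})\<close>; but then \<open>g\<close> belongs to the set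
  that was extended.\<close>

lemma fundamental_circuit_dependent:
  assumes B: "matroid_basis indep B" and e: "e \<notin> B"
  shows "\<not> indep (insert e {f \<in> B. matroid_basis indep (insert e (B - {f}))})"
    (is "\<not> indep (insert e ?K)")
proof
  assume "indep (insert e ?K)"
  from extend_within[OF this B] obtain C
    where C: "matroid_basis indep C" "insert e ?K \<subseteq> C" "C \<subseteq> insert e ?K \<union> B" by blast
  have "\<not> B \<subseteq> C" using B C e basis_indep[OF C(1)] unfolding matroid_basis_def by blast
  then obtain g where g: "g \<in> B" "g \<notin> C" by blast
  have sub: "C \<subseteq> insert e (B - {g})" using C g by blast
  have "card (insert e (B - {g})) = card C"
    using basis_card_eq[OF B C(1)] basis_finite[OF B] g e by (simp add: card.remove[of B g] del: card_Diff_insert card_Diff_singleton)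
  then have "C = insert e (B - {g})"
    using card_subset_eq[OF _ sub] basis_finite[OF B] by simp
  then show False using C g by blast
qed

text \<open>Let \<open>K\<close> be the fundamental circuit of \<open>e\<close> with respect to
  \<open>B'\<close>, without \<open>e\<close>. A basis \<open>C\<close> between \<open>K\<close> and
  \<open>K \<union> B\<close> cannot contain \<open>e\<close>, since \<open>insert e K\<close> is
  dependent. Augmenting \<open>B - {e}\<close> from \<open>C\<close> therefore adds an element of
  \<open>K\<close>, which serves both exchanges.\<close>

lemma symmetric_exchange:
  assumes B: "matroid_basis indep B" and B': "matroid_basis indep B'" and e: "e \<in> B" "e \<notin> B'"
  obtains f where "f \<in> B'" "f \<notin> B" "matroid_basis indep (insert f (B - {e}))"
    "matroid_basis indep (insert e (B' - {f}))"
proof -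
  define K where "K = {f \<in> B'. matroid_basis indep (insert e (B' - {f}))}"
  have dep: "\<not> indep (insert e K)"
    using fundamental_circuit_dependent[OF B' e(2)] unfolding K_def .
  have "indep K" using indep_mono[OF basis_indep[OF B'], of K] unfolding K_def by blast
  from extend_within[OF this B] obtain C
    where C: "matroid_basis indep C" "K \<subseteq> C" "C \<subseteq> K \<union> B" by blast
  have "e \<notin> C" using indep_mono[OF basis_indep[OF C(1)], of "insert e K"] C(2) dep by blast
  have i: "indep (B - {e})" using indep_mono[OF basis_indep[OF B]] by blast
  have "card (B - {e}) < card C"
    using basis_card_eq[OF B C(1)] basis_finite[OF B] e by (simp add: card.remove[of B e] del: card_Diff_insert card_Diff_singleton)
  from indep_augment[OF i basis_indep[OF C(1)] this] obtain f
    where f: "f \<in> C" "f \<notin> B - {e}" "indep (insert f (B - {e}))" by blast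
  have "f \<in> K" "f \<notin> B" using f C \<open>e \<notin> C\<close> by auto
  then show thesis
    using that basis_swap_indep[OF B e(1) _ f(3)] unfolding K_def by blast
qed

lemma exch_nbrs_sym:
  assumes "u \<in> E" "w \<in> exch_nbrs E indep B u"
  shows "u \<in> exch_nbrs E indep B w"
  using assms by (auto simp: exch_nbrs_def split: if_splits)

lemma exch_nbrs_nonempty:
  assumes B: "matroid_basis indep B" and u: "u \<in> E"
    and nl: "\<not> matroid_loop E indep u" and nc: "\<not> matroid_coloop E indep u"
  shows "exch_nbrs E indep B u \<noteq> {}"
proof (cases "u \<in> B")
  case True
  from nc u obtain B' where B': "matroid_basis indep B'" "u \<notin> B'" by (auto simp: coloop_iff)
  from symmetric_exchange[OF B B'(1) True B'(2)] obtain f where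
    "f \<in> B'" "f \<notin> B" "matroid_basis indep (insert f (B - {u}))" by blast
  then show ?thesis using True basis_subset[OF B'(1)] by (auto simp: exch_nbrs_def)
next
  case False
  have "exch_nbrs E indep B u = {f \<in> B. matroid_basis indep (insert u (B - {f}))}"
    using False by (simp add: exch_nbrs_def)
  moreover have "{f \<in> B. matroid_basis indep (insert u (B - {f}))} \<noteq> {}"
  proof
    assume "{f \<in> B. matroid_basis indep (insert u (B - {f}))} = {}"
    with fundamental_circuit_dependent[OF B False] nl u show False by (simp add: loop_iff)
  qed
  ultimately show ?thesis by simp
qed

section \<open>Activity intervals and the Tutte polynomial\<close>

lemma rank_eq_inter_card:
  assumes B: "matroid_basis indep B" and S: "S \<subseteq> E"
    and max: "\<And>C. matroid_basis indep C \<Longrightarrow> card (C \<inter> S) \<le> card (B \<inter> S)"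
  shows "matroid_rank indep S = card (B \<inter> S)"
  unfolding matroid_rank_def
proof (rule Max_eqI)
  show "finite (card ` {I. I \<subseteq> S \<and> indep I})"
    using finite_subset[OF S finite_ground] by auto
  show "card (B \<inter> S) \<in> card ` {I. I \<subseteq> S \<and> indep I}"
    using indep_mono[OF basis_indep[OF B], of "B \<inter> S"] by blast
next
  fix y assume "y \<in> card ` {I. I \<subseteq> S \<and> indep I}"
  then obtain I where I: "I \<subseteq> S" "indep I" "y = card I" by blast
  from extend_within[OF I(2) B] obtain C where C: "matroid_basis indep C" "I \<subseteq> C" by blast
  have "card I \<le> card (C \<inter> S)" using C I basis_finite by (intro card_mono) auto
  then show "y \<le> card (B \<inter> S)" using max[OF C(1)] I by simp
qed

lemma rank_ground:
  assumes B: "matroid_basis indep B"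
  shows "matroid_rank indep E = card B"
proof -
  have inter: "C \<inter> E = C" if "matroid_basis indep C" for C using basis_subset[OF that] by blast
  have "matroid_rank indep E = card (B \<inter> E)"
    by (rule rank_eq_inter_card[OF B order_refl]) (metis inter B basis_card_eq order_refl)
  then show ?thesis by (simp add: inter[OF B])
qed

text \<open>From any element of the symmetric difference of \<open>B\<close> and \<open>C\<close>, a
  symmetric exchange leads to another one with a smaller value of \<open>t\<close>; in a finite set
  this descent is impossible.\<close>

lemma activity_interval_unique:
  fixes t :: "'a \<Rightarrow> 'b::linorder"
  assumes B: "matroid_basis indep B" and C: "matroid_basis indep C"
    and SB: "B - active E indep B t \<subseteq> S" "S \<subseteq> B \<union> active E indep B t"
    and SC: "C - active E indep C t \<subseteq> S" "S \<subseteq> C \<union> active E indep C t"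
  shows "B = C"
proof -
  have descent: "\<exists>f \<in> C' - B'. t f < t e"
    if B': "matroid_basis indep B'" and C': "matroid_basis indep C'"
      and S: "B' - active E indep B' t \<subseteq> S" "S \<subseteq> C' \<union> active E indep C' t"
      and e: "e \<in> B'" "e \<notin> C'" for B' C' e
  proof -
    obtain f where f: "f \<in> C'" "f \<notin> B'" "matroid_basis indep (insert f (B' - {e}))"
      "matroid_basis indep (insert e (C' - {f}))"
      using symmetric_exchange[OF B' C' e] .
    have "f \<in> E" using f(1) basis_subset[OF C'] by blast
    then have nb: "f \<in> exch_nbrs E indep B' e" "f \<in> exch_nbrs E indep C' e"
      using f e by (auto simp: exch_nbrs_def)
    \<comment> \<open>If \<open>e\<close> is in \<open>S\<close>, the upper bound on
      \<open>S\<close> makes it active for \<open>C'\<close>; otherwise the lower bound makes it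
      active for \<open>B'\<close>. The element \<open>f\<close> is its neighbour for both
      bases.\<close>
    have "e \<in> active E indep B' t \<or> e \<in> active E indep C' t" using S e by blast
    then have "t f < t e" using nb by (auto simp: active_def)
    then show ?thesis using f by blast
  qed
  define D where "D = (B - C) \<union> (C - B)"
  have "finite D" unfolding D_def using basis_finite[OF B] basis_finite[OF C] by blast
  have "D = {}"
  proof (rule ccontr)
    assume "D \<noteq> {}"
    then obtain e where e: "e \<in> D" "\<And>x. x \<in> D \<Longrightarrow> \<not> t x < t e"
      using ex_is_arg_min_if_finite[OF \<open>finite D\<close>, of t] by (auto simp: is_arg_min_def)
    show False
      using descent[OF B C SB(1) SC(2)] descent[OF C B SC(1) SB(2)] e unfolding D_def by blast
  qed
  then show ?thesis unfolding D_def by blast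
qed

text \<open>The basis is greedy for \<open>S\<close>: it meets \<open>S\<close> in as many elements as possible, and among those
  bases it has the lightest part inside \<open>S\<close> and the heaviest part outside.\<close>

lemma activity_interval_exists:
  fixes t :: "'a \<Rightarrow> nat"
  assumes S: "S \<subseteq> E" and inj: "inj_on t E"
  obtains B where "matroid_basis indep B" "B - active E indep B t \<subseteq> S"
    "S \<subseteq> B \<union> active E indep B t" "matroid_rank indep S = card (B \<inter> S)"
proof -
  define \<phi> where "\<phi> B = (\<Sum>e\<in>B. if e \<in> S then - int (t e) else int (t e))" for B
  define MM where "MM = {B. matroid_basis indep B \<and>
    (\<forall>C. matroid_basis indep C \<longrightarrow> card (C \<inter> S) \<le> card (B \<inter> S))}"
  have finMM: "finite MM" unfolding MM_def by (rule finite_subset[OF _ finite_bases]) auto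
  have "Max ((\<lambda>C. card (C \<inter> S)) ` {B. matroid_basis indep B})
      \<in> (\<lambda>C. card (C \<inter> S)) ` {B. matroid_basis indep B}"
    using finite_bases basis_exists by (intro Max_in) auto
  then obtain B0 where "matroid_basis indep B0"
    "card (B0 \<inter> S) = Max ((\<lambda>C. card (C \<inter> S)) ` {B. matroid_basis indep B})" by auto
  then have "B0 \<in> MM" unfolding MM_def using finite_bases by auto
  then have "Max (\<phi> ` MM) \<in> \<phi> ` MM" using finMM by (intro Max_in) auto
  then obtain B where BM: "B \<in> MM" and B\<phi>: "\<And>C. C \<in> MM \<Longrightarrow> \<phi> C \<le> \<phi> B"
    using finMM by (metis (no_types, lifting) Max_ge finite_imageI image_eqI imageE)
  have B: "matroid_basis indep B"
    and Bmax: "\<And>C. matroid_basis indep C \<Longrightarrow> card (C \<inter> S) \<le> card (B \<inter> S)"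
    using BM unfolding MM_def by auto
  \<comment> \<open>Maximality of \<open>card (B \<inter> S)\<close> forces both swapped elements to
    lie on the same side of \<open>S\<close>, so the swapped basis competes in \<open>MM\<close>,
    and comparing \<open>\<phi>\<close> orders the two values. The two alternatives are
    \<open>u\<close> in the basis but outside \<open>S\<close>, and \<open>u\<close> in
    \<open>S\<close> but outside the basis.\<close>
  have swap: "t w < t u"
    if b: "matroid_basis indep (insert w' (B - {u'}))" and u': "u' \<in> B" and w': "w' \<in> E" "w' \<notin> B"
      and cases: "u' = u \<and> w' = w \<and> u \<notin> S \<or> u' = w \<and> w' = u \<and> u \<in> S" for u w u' w'
  proof -
    let ?C = "insert w' (B - {u'})"
    have fin: "finite B" by (rule basis_finite[OF B])
    have card_eq: "card (?C \<inter> S) + (if u' \<in> S then 1 else 0)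
        = card (B \<inter> S) + (if w' \<in> S then 1 else 0)"
    proof -
      have "?C \<inter> S = (if w' \<in> S then insert w' (B \<inter> S - {u'}) else B \<inter> S - {u'})" by auto
      moreover have "card (B \<inter> S) = card (B \<inter> S - {u'}) + (if u' \<in> S then 1 else 0)"
        using fin u' card.remove[of "B \<inter> S" u'] by auto
      ultimately show ?thesis using w' fin by auto
    qed
    have le: "card (?C \<inter> S) \<le> card (B \<inter> S)" by (rule Bmax[OF b])
    have same: "u' \<in> S \<longleftrightarrow> w' \<in> S" using cases card_eq le by (auto split: if_splits)
    then have "card (?C \<inter> S) = card (B \<inter> S)" using card_eq by (auto split: if_splits)
    then have "?C \<in> MM" unfolding MM_def using b Bmax by auto
    from B\<phi>[OF this] have "\<phi> ?C \<le> \<phi> B" .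
    moreover have "\<phi> ?C = \<phi> (B - {u'}) + (if w' \<in> S then - int (t w') else int (t w'))"
      unfolding \<phi>_def using w' fin by simp
    moreover have "\<phi> B = \<phi> (B - {u'}) + (if u' \<in> S then - int (t u') else int (t u'))"
      unfolding \<phi>_def using u' fin by (simp add: sum.remove[of B u'])
    ultimately have "t w \<le> t u" using cases same by (auto split: if_splits)
    moreover have "t w \<noteq> t u"
    proof -
      have "u' \<in> E" "u' \<noteq> w'" using u' w' basis_subset[OF B] by auto
      then show ?thesis using inj_onD[OF inj, of u' w'] w' cases by metis
    qed
    ultimately show "t w < t u" by simp
  qed
  have 1: "B - active E indep B t \<subseteq> S"
  proof
    fix u assume u: "u \<in> B - active E indep B t"
    show "u \<in> S"
    proof (rule ccontr)
      assume "u \<notin> S"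
      then have "t w < t u" if "w \<in> exch_nbrs E indep B u" for w
        using swap[of w u u w] that u by (auto simp: exch_nbrs_def)
      then show False using u basis_subset[OF B] by (auto simp: active_def)
    qed
  qed
  have 2: "S \<subseteq> B \<union> active E indep B t"
  proof
    fix u assume u: "u \<in> S"
    show "u \<in> B \<union> active E indep B t"
    proof (rule ccontr)
      assume n: "u \<notin> B \<union> active E indep B t"
      have "t w < t u" if "w \<in> exch_nbrs E indep B u" for w
        using swap[of u w u w] that u n S by (auto simp: exch_nbrs_def)
      then show False using u n S by (auto simp: active_def)
    qed
  qed
  show thesis using that[OF B 1 2] rank_eq_inter_card[OF B S Bmax] by blast
qed

text \<open>The intervals from \<open>B - act B\<close> to \<open>B \<union> act B\<close> partition
  the power set of \<open>E\<close>. Inside one of them corank and nullity of \<open>S\<close> are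
  the sizes of \<open>B - S\<close> and \<open>S - B\<close>, so the sum over the interval factors,
  each active element contributing \<open>(x - 1) + 1\<close> or \<open>(y - 1) + 1\<close>.\<close>

theorem tutte_activities:
  fixes t :: "'a \<Rightarrow> nat"
  assumes inj: "inj_on t E"
  shows "tutte E indep x y =
    (\<Sum>B | matroid_basis indep B. \<Prod>u\<in>active E indep B t. if u \<in> B then x else y)"
proof -
  define act where "act B = active E indep B t" for B
  define f where "f S = (x - 1) ^ (matroid_rank indep E - matroid_rank indep S)
    * (y - 1) ^ (card S - matroid_rank indep S)" for S
  define In where "In B = {S \<in> Pow E. B - act B \<subseteq> S \<and> S \<subseteq> B \<union> act B}" for B
  have act_sub: "act B \<subseteq> E" for B unfolding act_def active_def by blast
  have f_eq: "f S = (\<Prod>z\<in>(S - B) \<union> (B - S). if z \<in> B then x - 1 else y - 1)"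
    if B: "matroid_basis indep B" and S: "S \<in> In B" for B S
  proof -
    have SE: "S \<subseteq> E" using S unfolding In_def by blast
    obtain C where C: "matroid_basis indep C" "C - active E indep C t \<subseteq> S"
      "S \<subseteq> C \<union> active E indep C t" "matroid_rank indep S = card (C \<inter> S)"
      using activity_interval_exists[OF SE inj] .
    have "B = C" using S activity_interval_unique[OF B C(1) _ _ C(2,3)]
      unfolding In_def act_def by blast
    then have r: "matroid_rank indep S = card (B \<inter> S)" using C by simp
    have fin: "finite S" "finite B" using SE finite_ground finite_subset basis_finite[OF B] by auto
    have "matroid_rank indep E - matroid_rank indep S = card (B - S)"
      using rank_ground[OF B] r fin by (simp add: card_Diff_subset_Int)
    moreover have "card S - matroid_rank indep S = card (S - B)"
      using r fin by (simp add: card_Diff_subset_Int Int_commute)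
    moreover have "(\<Prod>z\<in>(S - B) \<union> (B - S). if z \<in> B then x - 1 else y - 1)
      = (y - 1) ^ card (S - B) * (x - 1) ^ card (B - S)"
      using fin by (subst prod.union_disjoint) auto
    ultimately show ?thesis unfolding f_def by simp
  qed
  have inner: "(\<Sum>S\<in>In B. f S) = (\<Prod>u\<in>act B. if u \<in> B then x else y)"
    if B: "matroid_basis indep B" for B
  proof -
    have fin: "finite (act B)" using act_sub finite_ground finite_subset by blast
    have BE: "B \<subseteq> E" by (rule basis_subset[OF B])
    have "(\<Prod>u\<in>act B. if u \<in> B then x else y)
        = (\<Prod>u\<in>act B. (if u \<in> B then x - 1 else y - 1) + 1)"
      by (intro prod.cong) auto
    also have "\<dots> = (\<Sum>Z\<in>Pow (act B). \<Prod>u\<in>Z. if u \<in> B then x - 1 else y - 1)"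
      using fin by (simp add: prod_add)
    \<comment> \<open>Symmetric difference with \<open>B\<close> is an involution that exchanges the
      subsets of \<open>act B\<close> with the members of the interval.\<close>
    also have "\<dots> = (\<Sum>S\<in>In B. f S)"
    proof (rule sum.reindex_bij_witness[where i = "\<lambda>S. (S - B) \<union> (B - S)"
          and j = "\<lambda>Z. (Z - B) \<union> (B - Z)"])
      fix Z assume Z: "Z \<in> Pow (act B)"
      show "(Z - B) \<union> (B - Z) - B \<union> (B - (Z - B \<union> (B - Z))) = Z" using Z by blast
      show In: "Z - B \<union> (B - Z) \<in> In B"
        using Z act_sub[of B] BE unfolding In_def by blast
      have *: "((Z - B \<union> (B - Z)) - B) \<union> (B - (Z - B \<union> (B - Z))) = Z" using Z by blast
      show "f (Z - B \<union> (B - Z)) = (\<Prod>u\<in>Z. if u \<in> B then x - 1 else y - 1)"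
        using f_eq[OF B In] unfolding * .
    next
      fix S assume S: "S \<in> In B"
      show "(S - B \<union> (B - S)) - B \<union> (B - (S - B \<union> (B - S))) = S" by blast
      show "S - B \<union> (B - S) \<in> Pow (act B)" using S unfolding In_def by blast
    qed
    finally show ?thesis by simp
  qed
  have "tutte E indep x y = (\<Sum>S\<in>Pow E. f S)" unfolding tutte_def f_def ..
  \<comment> \<open>Each \<open>S\<close> lies in exactly one interval, so the inner sum has a
    single term.\<close>
  also have "\<dots> = (\<Sum>S\<in>Pow E. \<Sum>B | B \<in> {B. matroid_basis indep B} \<and> S \<in> In B. f S)"
  proof (rule sum.cong[OF refl])
    fix S assume S: "S \<in> Pow E"
    then have "S \<subseteq> E" by simp
    obtain C where C: "matroid_basis indep C" "C - active E indep C t \<subseteq> S"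
      "S \<subseteq> C \<union> active E indep C t" "matroid_rank indep S = card (C \<inter> S)"
      using activity_interval_exists[OF \<open>S \<subseteq> E\<close> inj] .
    have "C \<in> {B. B \<in> {B. matroid_basis indep B} \<and> S \<in> In B}"
      using C S unfolding In_def act_def by simp
    moreover have "B = C" if "B \<in> {B. B \<in> {B. matroid_basis indep B} \<and> S \<in> In B}" for B
      using that activity_interval_unique[OF _ C(1) _ _ C(2,3), of B] unfolding In_def act_def by simp
    ultimately have "{B. B \<in> {B. matroid_basis indep B} \<and> S \<in> In B} = {C}" by blast
    then show "f S = (\<Sum>B | B \<in> {B. matroid_basis indep B} \<and> S \<in> In B. f S)" by simp
  qed
  also have "\<dots> = (\<Sum>B | matroid_basis indep B. \<Sum>S | S \<in> Pow E \<and> S \<in> In B. f S)"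
    using sum.swap_restrict[of "Pow E" "{B. matroid_basis indep B}" "\<lambda>S B. f S" "\<lambda>S B. S \<in> In B"]
      finite_bases finite_ground by simp
  also have "\<dots> = (\<Sum>B | matroid_basis indep B. \<Prod>u\<in>act B. if u \<in> B then x else y)"
  proof (rule sum.cong[OF refl])
    fix B assume B: "B \<in> {B. matroid_basis indep B}"
    have "{S. S \<in> Pow E \<and> S \<in> In B} = In B" unfolding In_def by blast
    then show "(\<Sum>S | S \<in> Pow E \<and> S \<in> In B. f S) = (\<Prod>u\<in>act B. if u \<in> B then x else y)"
      using inner B by simp
  qed
  finally show ?thesis unfolding act_def .
qed

end

section \<open>Contributions of a vertex and its leaves\<close>

lemma power_Suc_diff_bounds:
  fixes x :: real
  assumes "0 \<le> x"
  shows "real (Suc d) * x ^ d \<le> (x + 1) ^ Suc d - x ^ Suc d"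
    and "(x + 1) ^ Suc d - x ^ Suc d \<le> real (Suc d) * (x + 1) ^ d"
proof -
  have eq: "(x + 1) ^ Suc d - x ^ Suc d = (\<Sum>p<Suc d. (x + 1) ^ p * x ^ (d - p))"
    using diff_power_eq_sum[of "x + 1" d x] by simp
  have "(\<Sum>p<Suc d. x ^ d) \<le> (\<Sum>p<Suc d. (x + 1) ^ p * x ^ (d - p))"
  proof (rule sum_mono)
    fix p assume "p \<in> {..<Suc d}"
    then have "x ^ d = x ^ p * x ^ (d - p)" by (simp flip: power_add)
    also have "\<dots> \<le> (x + 1) ^ p * x ^ (d - p)"
      using assms by (intro mult_right_mono power_mono) auto
    finally show "x ^ d \<le> (x + 1) ^ p * x ^ (d - p)" .
  qed
  then show "real (Suc d) * x ^ d \<le> (x + 1) ^ Suc d - x ^ Suc d" unfolding eq by simp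
  have "(\<Sum>p<Suc d. (x + 1) ^ p * x ^ (d - p)) \<le> (\<Sum>p<Suc d. (x + 1) ^ d)"
  proof (rule sum_mono)
    fix p assume "p \<in> {..<Suc d}"
    then have "(x + 1) ^ d = (x + 1) ^ p * (x + 1) ^ (d - p)" by (simp flip: power_add)
    also have "\<dots> \<ge> (x + 1) ^ p * x ^ (d - p)"
      using assms by (intro mult_left_mono power_mono) auto
    finally show "(x + 1) ^ p * x ^ (d - p) \<le> (x + 1) ^ d" .
  qed
  then show "(x + 1) ^ Suc d - x ^ Suc d \<le> real (Suc d) * (x + 1) ^ d" unfolding eq by simp
qed

definition power_sum :: "nat \<Rightarrow> nat \<Rightarrow> real" where
  "power_sum d n = (\<Sum>x<n. real x ^ d)"

text \<open>Summing the bounds on \<open>(x + 1) ^ Suc d - x ^ Suc d\<close> over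
  \<open>x < n\<close> telescopes; replacing \<open>x + 1\<close> by \<open>x\<close> in the upper
  estimate costs at most \<open>real n ^ d\<close>.\<close>

lemma power_sum_bounds:
  "real n ^ Suc d - real (Suc d) * real n ^ d \<le> real (Suc d) * power_sum d n"
  "real (Suc d) * power_sum d n \<le> real n ^ Suc d"
proof -
  have "real (Suc d) * power_sum d n \<le> real n ^ Suc d \<and>
    real n ^ Suc d \<le> real (Suc d) * (\<Sum>x<n. (real x + 1) ^ d)"
  proof (induction n)
    case (Suc n)
    then show ?case
      using power_Suc_diff_bounds[of "real n" d]
      by (simp add: power_sum_def algebra_simps del: power_Suc)
  qed (simp add: power_sum_def)
  moreover have "(\<Sum>x<n. (real x + 1) ^ d) \<le> power_sum d n + real n ^ d"
  proof -
    have "(\<Sum>x<n. (real x + 1) ^ d) = (\<Sum>x<Suc n. real x ^ d) - 0 ^ d"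
      by (subst sum.lessThan_Suc_shift) (simp add: add.commute)
    also have "\<dots> \<le> power_sum d n + real n ^ d" by (simp add: power_sum_def)
    finally show ?thesis .
  qed
  then have "real (Suc d) * (\<Sum>x<n. (real x + 1) ^ d) \<le> real (Suc d) * (power_sum d n + real n ^ d)"
    by (intro mult_left_mono) auto
  ultimately show "real n ^ Suc d - real (Suc d) * real n ^ d \<le> real (Suc d) * power_sum d n"
    "real (Suc d) * power_sum d n \<le> real n ^ Suc d" by (simp_all add: algebra_simps)
qed

lemma power_sum_tendsto: "(\<lambda>n. power_sum d n / real n ^ Suc d) \<longlonglongrightarrow> 1 / real (Suc d)"
proof (rule tendsto_sandwich)
  have "(\<lambda>n. 1 / real (Suc d) - 1 / real n) \<longlonglongrightarrow> 1 / real (Suc d) - 0"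
    by (intro tendsto_intros lim_1_over_n)
  then show "(\<lambda>n. 1 / real (Suc d) - 1 / real n) \<longlonglongrightarrow> 1 / real (Suc d)" by simp
  show "\<forall>\<^sub>F n in sequentially. 1 / real (Suc d) - 1 / real n \<le> power_sum d n / real n ^ Suc d"
  proof (rule eventually_sequentiallyI[of 1])
    fix n :: nat assume "1 \<le> n"
    then have n: "real n > 0" by simp
    have "1 / real (Suc d) - 1 / real n
        = (real n ^ Suc d - real (Suc d) * real n ^ d) / (real (Suc d) * real n ^ Suc d)"
      using n by (simp add: divide_simps del: of_nat_Suc) (simp add: algebra_simps)
    also have "\<dots> \<le> real (Suc d) * power_sum d n / (real (Suc d) * real n ^ Suc d)"
      using n by (intro divide_right_mono power_sum_bounds) simp
    also have "\<dots> = power_sum d n / real n ^ Suc d" by (simp del: of_nat_Suc power_Suc)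
    finally show "1 / real (Suc d) - 1 / real n \<le> power_sum d n / real n ^ Suc d" .
  qed
  show "\<forall>\<^sub>F n in sequentially. power_sum d n / real n ^ Suc d \<le> 1 / real (Suc d)"
  proof (rule eventually_sequentiallyI[of 1])
    fix n :: nat assume "1 \<le> n"
    then show "power_sum d n / real n ^ Suc d \<le> 1 / real (Suc d)"
      using power_sum_bounds(2)[where n = n and d = d] by (simp add: field_simps)
  qed
qed (rule tendsto_const)

text \<open>In both factors \<open>k\<close> is the number of leaves at a vertex and \<open>m\<close> the number of its other
  neighbours.\<close>

definition active_factor :: "nat \<Rightarrow> nat \<Rightarrow> nat \<Rightarrow> real" where
  "active_factor n k m = (\<Sum>x<5*n. 1 / real (5*n) *
     ((real x / real (5*n)) ^ k * (1 + 4/3 * (min (real x / real (4*n)) 1) ^ m)))"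

definition inactive_factor :: "nat \<Rightarrow> nat \<Rightarrow> nat \<Rightarrow> real" where
  "inactive_factor n k m = (\<Sum>x<4*n. 1 / real (4*n) *
     ((1 + 4/3 * (1 - real (x + 1) / real (5*n))) ^ k - (real (x + 1) / real (5*n)) ^ (k + m)))"

section \<open>Asymptotics of the two factors\<close>

lemma active_factor_eq:
  assumes n: "n > 0"
  shows "active_factor n k m = power_sum k (5*n) / real (5*n) ^ Suc k
    + 4/3 * ((4/5) ^ Suc k * (power_sum (k + m) (4*n) / real (4*n) ^ Suc (k + m))
      + (power_sum k (5*n) / real (5*n) ^ Suc k
         - (4/5) ^ Suc k * (power_sum k (4*n) / real (4*n) ^ Suc k)))"
proof -
  define N where "N = real n"
  have N: "N > 0" using n by (simp add: N_def)
  let ?h = "\<lambda>x. 1 / (5*N) * (real x / (5*N)) ^ k"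
  have A: "(\<Sum>x<j. ?h x) = power_sum k j / (5*N) ^ Suc k" for j
    by (simp add: power_sum_def sum_divide_distrib power_divide)
  \<comment> \<open>The minimum in \<open>active_factor\<close> reaches 1 at \<open>x = 4*n\<close>,
    so both ranges consist of pure powers.\<close>
  have split: "(\<Sum>x<5*n. g x) = (\<Sum>x<4*n. g x) + (\<Sum>x=4*n..<5*n. g x)" for g :: "nat \<Rightarrow> real"
  proof -
    have "{..<5*n} = {..<4*n} \<union> {4*n..<5*n}" by auto
    moreover have "{..<4*n} \<inter> {4*n..<5*n} = {}" by auto
    ultimately show ?thesis using sum.union_disjoint[of "{..<4*n}" "{4*n..<5*n}" g]
      by (metis finite_lessThan finite_atLeastLessThan)
  qed
  have "active_factor n k m
      = (\<Sum>x<5*n. ?h x) + 4/3 * (\<Sum>x<5*n. ?h x * (min (real x / (4*N)) 1) ^ m)"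
    by (simp add: active_factor_def N_def sum_distrib_left flip: sum.distrib)
       (rule sum.cong, auto simp: field_simps)
  also have "(\<Sum>x<5*n. ?h x * (min (real x / (4*N)) 1) ^ m)
      = (\<Sum>x<4*n. ?h x * (real x / (4*N)) ^ m) + (\<Sum>x=4*n..<5*n. ?h x)"
    unfolding split
  proof (intro arg_cong2[of _ _ _ _ "(+)"] sum.cong refl)
    fix x assume "x \<in> {..<4*n}"
    then have "real x / (4*N) \<le> 1" using N by (simp add: N_def field_simps)
    then show "?h x * (min (real x / (4*N)) 1) ^ m = ?h x * (real x / (4*N)) ^ m" by simp
  next
    fix x assume "x \<in> {4*n..<5*n}"
    then have "real (4*n) \<le> real x" by (simp del: of_nat_mult)
    then have "1 \<le> real x / (4*N)" using N by (simp add: N_def)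
    then show "?h x * (min (real x / (4*N)) 1) ^ m = ?h x" by (simp add: min_absorb2)
  qed
  also have "(\<Sum>x=4*n..<5*n. ?h x) = (\<Sum>x<5*n. ?h x) - (\<Sum>x<4*n. ?h x)" by (simp add: split)
  also have "(\<Sum>x<4*n. ?h x * (real x / (4*N)) ^ m)
      = (4/5) ^ Suc k * (power_sum (k + m) (4*n) / (4*N) ^ Suc (k + m))"
    unfolding power_sum_def sum_divide_distrib sum_distrib_left
    using N by (intro sum.cong) (auto simp: field_simps power_add power_mult_distrib)
  finally have main: "active_factor n k m = (\<Sum>x<5*n. ?h x) + 4/3 *
      ((4/5) ^ Suc k * (power_sum (k + m) (4*n) / (4*N) ^ Suc (k + m))
        + ((\<Sum>x<5*n. ?h x) - (\<Sum>x<4*n. ?h x)))" .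
  have "power_sum k (4*n) / (5*N) ^ Suc k = (4/5) ^ Suc k * (power_sum k (4*n) / (4*N) ^ Suc k)"
    using N by (simp add: field_simps power_mult_distrib)
  then show ?thesis
    by (simp only: main A of_nat_mult of_nat_numeral flip: N_def)
qed

text \<open>The integral over \<open>x\<close> in [0, 1] of
  \<open>x ^ k * (1 + 4/3 * (min (5/4 * x) 1) ^ m)\<close>.\<close>

definition active_limit :: "nat \<Rightarrow> nat \<Rightarrow> real" where
  "active_limit k m = (1 + 4/3 * (1 - (4/5) ^ Suc k)) / real (Suc k)
    + 4/3 * (4/5) ^ Suc k / real (Suc (k + m))"

text \<open>Only a lower bound for the limiting average over \<open>x\<close> in [0, 4/5] of
  \<open>(1 + 4/3 * (1 - x)) ^ k - x ^ (k + m)\<close>: the first power is replaced by the power of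
  its mean, and that mean is 9/5.\<close>

definition inactive_limit :: "nat \<Rightarrow> nat \<Rightarrow> real" where
  "inactive_limit k m = (9/5) ^ k - (4/5) ^ (k + m) / real (Suc (k + m))"

lemma active_factor_tendsto: "(\<lambda>n. active_factor n k m) \<longlonglongrightarrow> active_limit k m"
proof -
  have sub: "(\<lambda>n. power_sum d (c*n) / real (c*n) ^ Suc d) \<longlonglongrightarrow> 1 / real (Suc d)"
    if "c > 0" for c d
    using LIMSEQ_subseq_LIMSEQ[OF power_sum_tendsto, of "\<lambda>n. c * n"] that
    by (simp add: strict_mono_def o_def)
  have "(\<lambda>n. power_sum k (5*n) / real (5*n) ^ Suc k
    + 4/3 * ((4/5) ^ Suc k * (power_sum (k + m) (4*n) / real (4*n) ^ Suc (k + m))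
      + (power_sum k (5*n) / real (5*n) ^ Suc k
         - (4/5) ^ Suc k * (power_sum k (4*n) / real (4*n) ^ Suc k))))
    \<longlonglongrightarrow> 1 / real (Suc k) + 4/3 * ((4/5) ^ Suc k * (1 / real (Suc (k + m)))
      + (1 / real (Suc k) - (4/5) ^ Suc k * (1 / real (Suc k))))"
    by (intro tendsto_intros sub) auto
  also have "1 / real (Suc k) + 4/3 * ((4/5) ^ Suc k * (1 / real (Suc (k + m)))
      + (1 / real (Suc k) - (4/5) ^ Suc k * (1 / real (Suc k)))) = active_limit k m"
    unfolding active_limit_def by (simp add: divide_simps) (simp add: algebra_simps)
  finally show ?thesis
    by (rule Lim_transform_eventually)
       (use active_factor_eq in \<open>auto intro!: eventually_sequentiallyI[of 1]\<close>)
qed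

text \<open>Jensen's inequality for the power function. The induction step uses that
  \<open>y x - c\<close> and \<open>y x ^ k - c ^ k\<close> have the same sign.\<close>

lemma power_mean:
  fixes y :: "nat \<Rightarrow> real"
  assumes n: "n > 0" and y: "\<And>x. x < n \<Longrightarrow> 0 \<le> y x" and c: "(\<Sum>x<n. y x) = real n * c"
  shows "real n * c ^ k \<le> (\<Sum>x<n. y x ^ k)"
proof (induction k)
  case (Suc k)
  have c0: "0 \<le> c" using sum_nonneg[of "{..<n}" y] y n c by (simp add: zero_le_mult_iff)
  have "0 \<le> (\<Sum>x<n. (y x - c) * (y x ^ k - c ^ k))"
  proof (rule sum_nonneg)
    fix x assume "x \<in> {..<n}"
    then have "0 \<le> y x" using y by simp
    then show "0 \<le> (y x - c) * (y x ^ k - c ^ k)"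
      using c0 power_mono[of "y x" c k] power_mono[of c "y x" k]
      by (cases "y x \<le> c") (auto intro: mult_nonneg_nonneg mult_nonpos_nonpos)
  qed
  also have "\<dots> = (\<Sum>x<n. y x ^ Suc k) - c * (\<Sum>x<n. y x ^ k) - c ^ k * (\<Sum>x<n. y x) + real n * c ^ Suc k"
    by (simp add: algebra_simps sum.distrib sum_subtractf sum_distrib_left)
  also have "\<dots> = (\<Sum>x<n. y x ^ Suc k) - c * (\<Sum>x<n. y x ^ k)" unfolding c by simp
  finally have "c * (\<Sum>x<n. y x ^ k) \<le> (\<Sum>x<n. y x ^ Suc k)" by simp
  moreover have "c * (real n * c ^ k) \<le> c * (\<Sum>x<n. y x ^ k)" using Suc c0 by (rule mult_left_mono)
  ultimately show ?case by (simp add: algebra_simps)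
qed simp

text \<open>The power mean inequality handles the \<open>k\<close>-th power, with grid mean
  \<open>9/5 - 2 / (15 * real n)\<close>; shifting the index of the subtracted power sum costs the
  term \<open>1 / real (4*n)\<close>.\<close>

lemma inactive_factor_ge:
  assumes n: "n > 0"
  shows "(9/5 - 2 / (15 * real n)) ^ k
      - (4/5) ^ (k + m) * (power_sum (k + m) (4*n) / real (4*n) ^ Suc (k + m) + 1 / real (4*n))
    \<le> inactive_factor n k m"
proof -
  define N where "N = real n"
  have N: "N > 0" using n by (simp add: N_def)
  let ?d = "k + m"
  have lin: "(\<Sum>x<j. 1 + 4/3 * (1 - real (x + 1) / (5*N)))
    = 7/3 * real j - 4 * real j * (real j + 1) / (30*N)" for j :: nat
  proof (induction j)
    case (Suc j)
    show ?case unfolding sum.lessThan_Suc Suc using N by (simp add: field_simps)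
  qed simp
  have lin4: "(\<Sum>x<4*n. 1 + 4/3 * (1 - real (x + 1) / (5*N))) = real (4*n) * (9/5 - 2 / (15*N))"
    unfolding lin using N by (simp add: N_def field_simps)
  have "real (4*n) * (9/5 - 2 / (15*N)) ^ k \<le> (\<Sum>x<4*n. (1 + 4/3 * (1 - real (x + 1) / (5*N))) ^ k)"
    by (rule power_mean[OF _ _ lin4]) (use n in \<open>auto simp: N_def field_simps\<close>)
  then have 1: "(9/5 - 2 / (15*N)) ^ k
      \<le> (\<Sum>x<4*n. 1 / (4*N) * (1 + 4/3 * (1 - real (x + 1) / (5*N))) ^ k)"
    unfolding sum_distrib_left[symmetric]
    using mult_left_mono[of _ _ "1 / (4*N)"] N by (simp add: N_def pos_le_divide_eq mult_ac)
  have "(\<Sum>x<4*n. real (x + 1) ^ ?d) \<le> power_sum ?d (4*n) + (4*N) ^ ?d"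
  proof -
    have "(\<Sum>x<4*n. real (x + 1) ^ ?d) = (\<Sum>x<Suc (4*n). real x ^ ?d) - 0 ^ ?d"
      by (subst sum.lessThan_Suc_shift) simp
    also have "\<dots> \<le> power_sum ?d (4*n) + (4*N) ^ ?d" by (simp add: power_sum_def N_def)
    finally show ?thesis .
  qed
  then have "(\<Sum>x<4*n. real (x + 1) ^ ?d) / (4*N) ^ Suc ?d
      \<le> (power_sum ?d (4*n) + (4*N) ^ ?d) / (4*N) ^ Suc ?d"
    using N by (intro divide_right_mono) auto
  also have "\<dots> = power_sum ?d (4*n) / (4*N) ^ Suc ?d + 1 / (4*N)"
    using N by (simp add: add_divide_distrib)
  finally have "(4/5) ^ ?d * ((\<Sum>x<4*n. real (x + 1) ^ ?d) / (4*N) ^ Suc ?d)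
      \<le> (4/5) ^ ?d * (power_sum ?d (4*n) / (4*N) ^ Suc ?d + 1 / (4*N))"
    by (rule mult_left_mono) simp
  moreover have "(4/5) ^ ?d * ((\<Sum>x<4*n. real (x + 1) ^ ?d) / (4*N) ^ Suc ?d)
      = (\<Sum>x<4*n. 1 / (4*N) * (real (x + 1) / (5*N)) ^ ?d)"
    unfolding sum_divide_distrib sum_distrib_left
    using N by (intro sum.cong) (auto simp: field_simps power_mult_distrib)
  ultimately have 2: "(\<Sum>x<4*n. 1 / (4*N) * (real (x + 1) / (5*N)) ^ ?d)
      \<le> (4/5) ^ ?d * (power_sum ?d (4*n) / (4*N) ^ Suc ?d + 1 / (4*N))" by simp
  have "inactive_factor n k m = (\<Sum>x<4*n. 1 / (4*N) * (1 + 4/3 * (1 - real (x + 1) / (5*N))) ^ k)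
      - (\<Sum>x<4*n. 1 / (4*N) * (real (x + 1) / (5*N)) ^ ?d)"
    by (simp add: inactive_factor_def N_def right_diff_distrib sum_subtractf)
  then show ?thesis using 1 2 by (simp add: N_def)
qed

lemma inactive_lower_tendsto:
  "(\<lambda>n. (9/5 - 2 / (15 * real n)) ^ k
      - (4/5) ^ (k + m) * (power_sum (k + m) (4*n) / real (4*n) ^ Suc (k + m) + 1 / real (4*n)))
    \<longlonglongrightarrow> inactive_limit k m"
proof -
  have sub: "(\<lambda>n. f (4*n)) \<longlonglongrightarrow> l" if "f \<longlonglongrightarrow> l" for f :: "nat \<Rightarrow> real" and l
    using LIMSEQ_subseq_LIMSEQ[OF that, of "\<lambda>n. 4 * n"] by (simp add: strict_mono_def o_def)
  have "(\<lambda>n. 9/5 - 2/15 * (1 / real n)) \<longlonglongrightarrow> 9/5 - 2/15 * 0"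
    by (intro tendsto_intros lim_1_over_n)
  then have c: "(\<lambda>n. 9/5 - 2 / (15 * real n)) \<longlonglongrightarrow> 9/5" by simp
  have "(\<lambda>n. (9/5 - 2 / (15 * real n)) ^ k
      - (4/5) ^ (k + m) * (power_sum (k + m) (4*n) / real (4*n) ^ Suc (k + m) + 1 / real (4*n)))
    \<longlonglongrightarrow> (9/5) ^ k - (4/5) ^ (k + m) * (1 / real (Suc (k + m)) + 0)"
    by (intro tendsto_intros c sub[OF power_sum_tendsto] sub[OF lim_1_over_n])
  then show ?thesis by (simp add: inactive_limit_def)
qed

section \<open>The limiting inequality for one group\<close>

lemma concave_quadratic_gt:
  fixes p q b c x y :: real
  assumes "0 \<le> x" "x \<le> y" "0 < y" "0 \<le> b" "0 \<le> c" "p * q > 1" "(p - b * y) * (q + c * y) > 1"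
  shows "(p - b * x) * (q + c * x) > 1"
proof -
  \<comment> \<open>As a function of \<open>x\<close> the product is a concave quadratic. The right
    side interpolates linearly between the values at 0 and \<open>y\<close>; its last summand is the
    excess over the chord.\<close>
  have "y * ((p - b * x) * (q + c * x) - 1)
      = (y - x) * (p * q - 1) + x * ((p - b * y) * (q + c * y) - 1) + b * c * x * y * (y - x)"
    by (simp add: algebra_simps)
  moreover have "0 \<le> b * c * x * y * (y - x)" "0 \<le> x * ((p - b * y) * (q + c * y) - 1)"
    "0 \<le> (y - x) * (p * q - 1)" using assms by auto
  moreover have "0 < (y - x) * (p * q - 1) \<or> 0 < x * ((p - b * y) * (q + c * y) - 1)"
    using assms by (cases "x = 0") auto
  ultimately have "0 < y * ((p - b * x) * (q + c * x) - 1)" by linarith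
  then show ?thesis using assms by (simp add: zero_less_mult_iff)
qed

text \<open>For \<open>k = 0\<close> and \<open>k = 1\<close> the reciprocal of the degree plus one
  is a variable \<open>x\<close> in a short interval, and the product is bounded below by a concave
  quadratic, so the endpoints decide. For larger \<open>k\<close> the growth of
  \<open>(9/5) ^ k\<close> suffices.\<close>

lemma limit_product_gt_1:
  assumes "k \<ge> 1 \<or> m \<ge> 2"
  shows "4/5 * active_limit k m * inactive_limit k m > 1"
proof -
  consider "k = 0" "m \<ge> 2" | "k = 1" | "k \<ge> 2" using assms by linarith
  then show ?thesis
  proof cases
    case 1
    define x where "x = 1 / real (Suc m)"
    have x: "0 \<le> x" "x \<le> 1/3" using 1 by (auto simp: x_def field_simps)
    have "(4/5 :: real) ^ m \<le> (4/5) ^ 2" using 1 by (intro power_decreasing) auto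
    then have "(4/5) ^ m * x \<le> 16/25 * x" using x by (intro mult_right_mono) (auto simp: power2_eq_square)
    moreover have "inactive_limit k m = 1 - (4/5) ^ m * x" using 1 by (simp add: inactive_limit_def x_def)
    ultimately have "1 - 16/25 * x \<le> inactive_limit k m" by simp
    moreover have "active_limit k m = 19/15 + 16/15 * x"
      using 1 by (simp add: active_limit_def x_def)
    moreover have "(4/5 - 64/125 * x) * (19/15 + 16/15 * x) > 1"
      by (rule concave_quadratic_gt[where y = "1/3"]) (use x in auto)
    ultimately have low: "1 - 16/25 * x \<le> inactive_limit k m" and act: "active_limit k m = 19/15 + 16/15 * x"
      and gt: "(4/5 - 64/125 * x) * (19/15 + 16/15 * x) > 1" by auto
    have "4/5 - 64/125 * x \<le> 4/5 * inactive_limit k m" using low by simp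
    then have "(4/5 - 64/125 * x) * (19/15 + 16/15 * x) \<le> (4/5 * inactive_limit k m) * (19/15 + 16/15 * x)"
      using x by (intro mult_right_mono) auto
    with gt show ?thesis by (simp only: act mult_ac)
  next
    case 2
    define x where "x = 1 / real (Suc (Suc m))"
    have x: "0 \<le> x" "x \<le> 1/2" by (auto simp: x_def field_simps)
    have "(4/5 :: real) ^ Suc m \<le> (4/5) ^ 1" by (intro power_decreasing) auto
    then have "(4/5) ^ Suc m * x \<le> 4/5 * x" using x by (intro mult_right_mono) auto
    moreover have "inactive_limit k m = 9/5 - (4/5) ^ Suc m * x" using 2 by (simp add: inactive_limit_def x_def)
    ultimately have "9/5 - 4/5 * x \<le> inactive_limit k m" by simp
    moreover have "active_limit k m = 37/50 + 64/75 * x"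
      using 2 by (simp add: active_limit_def x_def power2_eq_square)
    moreover have "(36/25 - 16/25 * x) * (37/50 + 64/75 * x) > 1"
      by (rule concave_quadratic_gt[where y = "1/2"]) (use x in auto)
    ultimately have low: "9/5 - 4/5 * x \<le> inactive_limit k m" and act: "active_limit k m = 37/50 + 64/75 * x"
      and gt: "(36/25 - 16/25 * x) * (37/50 + 64/75 * x) > 1" by auto
    have "36/25 - 16/25 * x \<le> 4/5 * inactive_limit k m" using low by simp
    then have "(36/25 - 16/25 * x) * (37/50 + 64/75 * x) \<le> (4/5 * inactive_limit k m) * (37/50 + 64/75 * x)"
      using x by (intro mult_right_mono) auto
    with gt show ?thesis by (simp only: act mult_ac)
  next
    case 3
    \<comment> \<open>The constant fits below the base case \<open>81/25 \<ge> 2 + 61/50\<close>,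
      and still leaves \<open>k + 1\<close> after the subtraction of at most 16/75.\<close>
    have p: "(9/5 :: real) ^ k \<ge> real k + 61/50"
      using 3
    proof (induction k rule: dec_induct)
      case (step j)
      then show ?case by simp
    qed (simp add: power2_eq_square)
    have "(4/5 :: real) ^ (k + m) \<le> (4/5) ^ 2" using 3 by (intro power_decreasing) auto
    then have "(4/5 :: real) ^ (k + m) / real (Suc (k + m)) \<le> (16/25) / 3"
      using 3 by (intro frac_le) (auto simp: power2_eq_square)
    with p have i: "inactive_limit k m \<ge> real k + 1" unfolding inactive_limit_def by simp
    have "(4/5 :: real) ^ Suc k \<le> (4/5) ^ 3" using 3 by (intro power_decreasing) auto
    then have "8/5 / real (Suc k) \<le> (1 + 4/3 * (1 - (4/5) ^ Suc k)) / real (Suc k)"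
      by (intro divide_right_mono) (auto simp: power3_eq_cube)
    also have "\<dots> \<le> active_limit k m" unfolding active_limit_def by simp
    finally have a: "8/5 / real (Suc k) \<le> active_limit k m" .
    have "8/5 = 8/5 / real (Suc k) * (real k + 1)" by (simp add: field_simps)
    also have "\<dots> \<le> active_limit k m * inactive_limit k m"
      using a i by (intro mult_mono) (auto intro: order_trans[OF _ a])
    finally show ?thesis by simp
  qed
qed

lemma eventually_factor_product_ge_1:
  assumes "k \<ge> 1 \<or> m \<ge> 2"
  shows "\<forall>\<^sub>F n in sequentially. 4/5 * active_factor n k m * inactive_factor n k m \<ge> 1"
proof -
  let ?l = "\<lambda>n. (9/5 - 2 / (15 * real n)) ^ k
      - (4/5) ^ (k + m) * (power_sum (k + m) (4*n) / real (4*n) ^ Suc (k + m) + 1 / real (4*n))"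
  have "(\<lambda>n. 4/5 * active_factor n k m * ?l n) \<longlonglongrightarrow> 4/5 * active_limit k m * inactive_limit k m"
    by (intro tendsto_intros active_factor_tendsto inactive_lower_tendsto)
  then have "\<forall>\<^sub>F n in sequentially. 4/5 * active_factor n k m * ?l n > 1"
    using order_tendstoD(1) limit_product_gt_1[OF assms] by blast
  then show ?thesis using eventually_gt_at_top[of "0::nat"]
  proof eventually_elim
    case (elim n)
    have "active_factor n k m \<ge> 0" unfolding active_factor_def
      by (intro sum_nonneg mult_nonneg_nonneg) auto
    then have "4/5 * active_factor n k m * ?l n \<le> 4/5 * active_factor n k m * inactive_factor n k m"
      using inactive_factor_ge[OF elim(2)] by (intro mult_left_mono) auto
    then show ?case using elim by linarith
  qed
qed

section \<open>Harris' inequality for finite product distributions\<close>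

text \<open>This is the expectation for independent coordinates once every \<open>p v\<close> has
  total weight 1, as \<open>product_distribution\<close> demands.\<close>

definition expectation_on :: "'a set \<Rightarrow> 'b set \<Rightarrow> ('a \<Rightarrow> 'b \<Rightarrow> real) \<Rightarrow> (('a \<Rightarrow> 'b) \<Rightarrow> real) \<Rightarrow> real" where
  "expectation_on V X p f = (\<Sum>t \<in> V \<rightarrow>\<^sub>E X. (\<Prod>v\<in>V. p v (t v)) * f t)"

lemma expectation_on_insert:
  assumes V: "finite V" and u: "u \<notin> V"
  shows "expectation_on (insert u V) X p f = (\<Sum>x\<in>X. p u x * expectation_on V X p (\<lambda>t. f (t(u := x))))"
proof -
  have inj: "inj_on (\<lambda>(y, g). g(u := y)) (X \<times> (V \<rightarrow>\<^sub>E X))"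
    using inj_combinator[OF u, of "\<lambda>_. X"] by simp
  have "expectation_on (insert u V) X p f =
    (\<Sum>(x, t)\<in>X \<times> (V \<rightarrow>\<^sub>E X). (\<Prod>v\<in>insert u V. p v ((t(u := x)) v)) * f (t(u := x)))"
    unfolding expectation_on_def PiE_insert_eq sum.reindex[OF inj] by (simp add: case_prod_unfold)
  also have "\<dots> = (\<Sum>x\<in>X. \<Sum>t\<in>V \<rightarrow>\<^sub>E X. p u x * ((\<Prod>v\<in>V. p v (t v)) * f (t(u := x))))"
    unfolding sum.cartesian_product[symmetric]
  proof (intro sum.cong refl)
    fix x t
    have "(\<Prod>v\<in>V. p v ((t(u := x)) v)) = (\<Prod>v\<in>V. p v (t v))"
      using u by (intro prod.cong) auto
    then show "(\<Prod>v\<in>insert u V. p v ((t(u := x)) v)) * f (t(u := x))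
      = p u x * ((\<Prod>v\<in>V. p v (t v)) * f (t(u := x)))"
      using V u by simp
  qed
  finally show ?thesis by (simp add: expectation_on_def sum_distrib_left)
qed

lemma expectation_on_prod:
  assumes "finite V" "finite X"
  shows "expectation_on V X p (\<lambda>t. \<Prod>v\<in>V. h v (t v)) = (\<Prod>v\<in>V. \<Sum>x\<in>X. p v x * h v x)"
  using prod_sum_PiE[of V "\<lambda>_. X" "\<lambda>v x. p v x * h v x"] assms
  by (simp add: expectation_on_def prod.distrib)

lemma expectation_on_mono:
  assumes "\<And>v x. v \<in> V \<Longrightarrow> 0 \<le> p v x" "\<And>t. t \<in> V \<rightarrow>\<^sub>E X \<Longrightarrow> f t \<le> g t"
  shows "expectation_on V X p f \<le> expectation_on V X p g"
  unfolding expectation_on_def by (intro sum_mono mult_left_mono prod_nonneg) (use assms in auto)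

text \<open>Serves to pass from values conditioned to lie below a cutoff back to uniform ones:
  \<open>c v\<close> is the probability of the condition, and the discarded outcomes contribute
  nonnegatively.\<close>

lemma expectation_on_scale:
  assumes p: "\<And>v x. v \<in> V \<Longrightarrow> 0 \<le> c v * q v x" "\<And>v x. v \<in> V \<Longrightarrow> c v * q v x \<le> p v x"
    and f: "\<And>t. 0 \<le> f t"
  shows "(\<Prod>v\<in>V. c v) * expectation_on V X q f \<le> expectation_on V X p f"
  unfolding expectation_on_def sum_distrib_left
proof (rule sum_mono)
  fix t
  have "(\<Prod>v\<in>V. c v) * ((\<Prod>v\<in>V. q v (t v)) * f t) = (\<Prod>v\<in>V. c v * q v (t v)) * f t"
    by (simp add: prod.distrib)
  also have "\<dots> \<le> (\<Prod>v\<in>V. p v (t v)) * f t"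
    using p f by (intro mult_right_mono prod_mono) auto
  finally show "(\<Prod>v\<in>V. c v) * ((\<Prod>v\<in>V. q v (t v)) * f t) \<le> (\<Prod>v\<in>V. p v (t v)) * f t" .
qed

lemma expectation_on_diff:
  "expectation_on V X p (\<lambda>t. f t - g t) = expectation_on V X p f - expectation_on V X p g"
  by (simp add: expectation_on_def right_diff_distrib sum_subtractf)

lemma expectation_on_add:
  "expectation_on V X p (\<lambda>t. f t + g t) = expectation_on V X p f + expectation_on V X p g"
  by (simp add: expectation_on_def distrib_left sum.distrib)

lemma expectation_on_cmult:
  "expectation_on V X p (\<lambda>t. c * f t) = c * expectation_on V X p f"
  by (simp add: expectation_on_def sum_distrib_left mult_ac)

lemma expectation_on_sum:
  "expectation_on V X p (\<lambda>t. \<Sum>i\<in>I. f i t) = (\<Sum>i\<in>I. expectation_on V X p (f i))"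
  unfolding expectation_on_def sum_distrib_left by (rule sum.swap)

definition coordinatewise_mono :: "'a set \<Rightarrow> ('a \<Rightarrow> 'b \<Rightarrow> 'b \<Rightarrow> bool) \<Rightarrow> (('a \<Rightarrow> 'b) \<Rightarrow> real) \<Rightarrow> bool" where
  "coordinatewise_mono V le f \<longleftrightarrow> (\<forall>s t. (\<forall>v\<in>V. le v (s v) (t v)) \<longrightarrow> f s \<le> f t)"

locale product_distribution =
  fixes V :: "'a set" and X :: "'b set" and p :: "'a \<Rightarrow> 'b \<Rightarrow> real" and le :: "'a \<Rightarrow> 'b \<Rightarrow> 'b \<Rightarrow> bool"
  assumes fin: "finite V" "finite X"
    and nonneg: "\<And>v x. v \<in> V \<Longrightarrow> 0 \<le> p v x"
    and total: "\<And>v. v \<in> V \<Longrightarrow> (\<Sum>x\<in>X. p v x) = 1"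
    and linear: "\<And>v x y. v \<in> V \<Longrightarrow> le v x y \<or> le v y x"

text \<open>Expand the nonnegative double sum of
  \<open>w x * w y * ((f x - f y) * (g x - g y))\<close>; it is twice the difference of the two
  sides.\<close>

lemma chebyshev_sum:
  fixes w :: "'b \<Rightarrow> real"
  assumes w: "\<And>x. 0 \<le> w x" "(\<Sum>x\<in>X. w x) = 1"
    and comonotone: "\<And>x y. 0 \<le> (f x - f y) * (g x - g y)"
  shows "(\<Sum>x\<in>X. w x * f x) * (\<Sum>x\<in>X. w x * g x) \<le> (\<Sum>x\<in>X. w x * (f x * g x))"
proof -
  let ?fg = "\<Sum>x\<in>X. w x * (f x * g x)" and ?f = "\<Sum>x\<in>X. w x * f x" and ?g = "\<Sum>x\<in>X. w x * g x"
  have "0 \<le> (\<Sum>x\<in>X. \<Sum>y\<in>X. w x * w y * ((f x - f y) * (g x - g y)))"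
    by (intro sum_nonneg mult_nonneg_nonneg[OF _ comonotone]) (simp add: w)
  also have "\<dots> = (\<Sum>x\<in>X. \<Sum>y\<in>X. (w x * (f x * g x)) * w y) + (\<Sum>x\<in>X. \<Sum>y\<in>X. w x * (w y * (f y * g y)))
      - (\<Sum>x\<in>X. \<Sum>y\<in>X. (w x * f x) * (w y * g y)) - (\<Sum>x\<in>X. \<Sum>y\<in>X. (w x * g x) * (w y * f y))"
    by (simp add: algebra_simps flip: sum.distrib sum_subtractf)
  also have "\<dots> = ?fg * 1 + 1 * ?fg - ?f * ?g - ?g * ?f"
    by (simp only: sum_product[symmetric] w)
  finally show ?thesis by (simp add: mult.commute)
qed

text \<open>The coordinate orders need not agree, so a function may be increasing in
  some coordinates and decreasing in others.\<close>

theorem harris_inequality: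
  assumes "product_distribution V X p le" "coordinatewise_mono V le f" "coordinatewise_mono V le g"
  shows "expectation_on V X p f * expectation_on V X p g \<le> expectation_on V X p (\<lambda>t. f t * g t)"
proof -
  have "finite V" using assms(1) by (simp add: product_distribution_def)
  then show ?thesis using assms
  proof (induction V arbitrary: f g rule: finite_induct)
    case empty
    then show ?case by (simp add: expectation_on_def)
  next
    case (insert u V)
    interpret product_distribution "insert u V" X p le by (rule insert.prems)
    have pd: "product_distribution V X p le"
      by unfold_locales (use fin nonneg total linear in auto)
    have mono_upd: "coordinatewise_mono V le (\<lambda>t. h (t(u := x)))"
      if "coordinatewise_mono (insert u V) le h" for h :: "('a \<Rightarrow> 'b) \<Rightarrow> real" and x
      using that linear[of u x x] insert.hyps unfolding coordinatewise_mono_def by auto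
    \<comment> \<open>The conditional expectation given that coordinate \<open>u\<close> has value
      \<open>x\<close>. It is monotone in \<open>x\<close>, so Chebyshev's inequality treats this
      coordinate and the induction hypothesis treats the others.\<close>
    let ?F = "\<lambda>h x. expectation_on V X p (\<lambda>t. h (t(u := x)))"
    have mono_F: "?F h x \<le> ?F h y"
      if "coordinatewise_mono (insert u V) le h" "le u x y" for h :: "('a \<Rightarrow> 'b) \<Rightarrow> real" and x y
    proof (rule expectation_on_mono)
      fix t :: "'a \<Rightarrow> 'b"
      have "\<forall>v\<in>insert u V. le v ((t(u := x)) v) ((t(u := y)) v)" using that linear by fastforce
      then show "h (t(u := x)) \<le> h (t(u := y))" using that(1) unfolding coordinatewise_mono_def by blast
    qed (use nonneg in auto)
    have "(\<Sum>x\<in>X. p u x * ?F f x) * (\<Sum>x\<in>X. p u x * ?F g x) \<le> (\<Sum>x\<in>X. p u x * (?F f x * ?F g x))"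
    proof (rule chebyshev_sum)
      fix x y
      show "0 \<le> (?F f x - ?F f y) * (?F g x - ?F g y)"
      proof (cases "le u x y")
        case True
        show ?thesis
          using mono_F[OF insert.prems(2) True] mono_F[OF insert.prems(3) True]
          by (intro mult_nonpos_nonpos) (simp_all only: diff_le_0_iff_le diff_ge_0_iff_ge)
      next
        case False
        then have "le u y x" using linear[of u x y] by simp
        show ?thesis
          using mono_F[OF insert.prems(2) \<open>le u y x\<close>] mono_F[OF insert.prems(3) \<open>le u y x\<close>]
          by (intro mult_nonneg_nonneg) (simp_all only: diff_le_0_iff_le diff_ge_0_iff_ge)
      qed
    qed (use fin nonneg total in auto)
    also have "\<dots> \<le> (\<Sum>x\<in>X. p u x * ?F (\<lambda>t. f t * g t) x)"
      by (intro sum_mono mult_left_mono nonneg insert.IH[OF pd] mono_upd insert.prems(2,3)) simp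
    finally show ?case by (simp add: expectation_on_insert[OF insert.hyps(1,2)])
  qed
qed

context product_distribution
begin

lemma expectation_on_const: "expectation_on V X p (\<lambda>t. c) = c"
proof -
  have "expectation_on V X p (\<lambda>t. c * (\<Prod>v\<in>V. 1)) = c"
    unfolding expectation_on_cmult expectation_on_prod[OF fin, of p "\<lambda>_ _. 1"] by (simp add: total)
  then show ?thesis by simp
qed

lemma expectation_on_nonneg: "(\<And>t. 0 \<le> f t) \<Longrightarrow> 0 \<le> expectation_on V X p f"
  unfolding expectation_on_def by (intro sum_nonneg mult_nonneg_nonneg prod_nonneg) (use nonneg in auto)

text \<open>Nonnegativity keeps the partial products monotone, so the inequality for two functions
  can be iterated.\<close>

lemma harris_inequality_prod:
  assumes I: "finite I" and mono: "\<And>i. i \<in> I \<Longrightarrow> coordinatewise_mono V le (f i)"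
    and f: "\<And>i t. i \<in> I \<Longrightarrow> 0 \<le> f i t"
  shows "(\<Prod>i\<in>I. expectation_on V X p (f i)) \<le> expectation_on V X p (\<lambda>t. \<Prod>i\<in>I. f i t)"
proof -
  have "coordinatewise_mono V le (\<lambda>t. \<Prod>i\<in>I. f i t) \<and>
    (\<Prod>i\<in>I. expectation_on V X p (f i)) \<le> expectation_on V X p (\<lambda>t. \<Prod>i\<in>I. f i t)"
    using I mono f
  proof (induction I rule: finite_induct)
    case empty
    show ?case by (simp add: coordinatewise_mono_def expectation_on_const)
  next
    case (insert i I)
    have IH: "coordinatewise_mono V le (\<lambda>t. \<Prod>i\<in>I. f i t)"
      "(\<Prod>i\<in>I. expectation_on V X p (f i)) \<le> expectation_on V X p (\<lambda>t. \<Prod>i\<in>I. f i t)"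
      using insert by auto
    have mi: "coordinatewise_mono V le (f i)" using insert.prems by simp
    have "coordinatewise_mono V le (\<lambda>t. f i t * (\<Prod>i\<in>I. f i t))"
      unfolding coordinatewise_mono_def
    proof (intro allI impI mult_mono)
      fix s t assume st: "\<forall>v\<in>V. le v (s v) (t v)"
      show "f i s \<le> f i t" using mi st unfolding coordinatewise_mono_def by blast
      show "(\<Prod>i\<in>I. f i s) \<le> (\<Prod>i\<in>I. f i t)" using IH(1) st unfolding coordinatewise_mono_def by blast
      show "0 \<le> f i t" "0 \<le> (\<Prod>i\<in>I. f i s)" using insert.prems by (auto intro: prod_nonneg)
    qed
    moreover have "expectation_on V X p (f i) * (\<Prod>i\<in>I. expectation_on V X p (f i))
      \<le> expectation_on V X p (f i) * expectation_on V X p (\<lambda>t. \<Prod>i\<in>I. f i t)"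
      using IH(2) insert.prems by (intro mult_left_mono expectation_on_nonneg) auto
    moreover note harris_inequality[OF product_distribution_axioms mi IH(1)]
    ultimately show ?case using insert.hyps by simp
  qed
  then show ?thesis by blast
qed

text \<open>Conditioning on the coordinate \<open>u\<close> makes the factors of a star around \<open>u\<close> independent.\<close>

lemma expectation_on_star:
  assumes u: "u \<in> V" and W: "W \<subseteq> V - {u}"
  shows "expectation_on V X p (\<lambda>t. g (t u) * (\<Prod>v\<in>W. h v (t v) (t u)))
    = (\<Sum>x\<in>X. p u x * (g x * (\<Prod>v\<in>W. \<Sum>y\<in>X. p v y * h v y x)))"
proof -
  define V' where "V' = V - {u}"
  have V: "V = insert u V'" "finite V'" "u \<notin> V'" "W \<subseteq> V'"
    using u W fin unfolding V'_def by auto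
  have inner: "expectation_on V' X p (\<lambda>t. g x * (\<Prod>v\<in>W. h v ((t(u := x)) v) x))
    = g x * (\<Prod>v\<in>W. \<Sum>y\<in>X. p v y * h v y x)" for x
  proof -
    have split: "prod f V' = prod f W * prod f (V' - W)" for f :: "'a \<Rightarrow> real"
      using V(2,4) by (metis prod.subset_diff mult.commute)
    have "(\<Prod>v\<in>W. h v ((t(u := x)) v) x) = (\<Prod>v\<in>V'. if v \<in> W then h v (t v) x else 1)" for t
    proof -
      have "(\<Prod>v\<in>W. h v ((t(u := x)) v) x) = (\<Prod>v\<in>W. if v \<in> W then h v (t v) x else 1)"
        using V(3,4) by (intro prod.cong) auto
      then show ?thesis by (simp add: split)
    qed
    then have "expectation_on V' X p (\<lambda>t. g x * (\<Prod>v\<in>W. h v ((t(u := x)) v) x))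
      = g x * (\<Prod>v\<in>V'. \<Sum>y\<in>X. p v y * (if v \<in> W then h v y x else 1))"
      by (simp add: expectation_on_cmult
        expectation_on_prod[OF V(2) fin(2), of p "\<lambda>v y. if v \<in> W then h v y x else 1"])
    also have "(\<Prod>v\<in>V'. \<Sum>y\<in>X. p v y * (if v \<in> W then h v y x else 1))
      = (\<Prod>v\<in>W. \<Sum>y\<in>X. p v y * h v y x)"
    proof -
      have "(\<Prod>v\<in>V'-W. \<Sum>y\<in>X. p v y * (if v \<in> W then h v y x else 1)) = 1"
        using total by (intro prod.neutral) (auto simp: V'_def)
      then show ?thesis by (simp add: split)
    qed
    finally show ?thesis .
  qed
  show ?thesis
    unfolding V(1) expectation_on_insert[OF V(2,3)] using inner by simp
qed

end

section \<open>Random orders on the exchange graph\<close>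

lemma prod_of_bool_all: "finite A \<Longrightarrow> (\<Prod>w\<in>A. of_bool (R w)) = (of_bool (\<forall>w\<in>A. R w) :: real)"
  by (induction A rule: finite_induct) auto

lemma sum_of_bool_less: "x \<le> N \<Longrightarrow> (\<Sum>y<N. of_bool (y < x)) = (real x)"
proof -
  assume "x \<le> N"
  then have "{..<N} \<inter> {y. y < x} = {..<x}" by auto
  then show ?thesis by simp
qed

text \<open>A lower bound for the activity product of one basis: vertices of \<open>P\<close> may be
  active and then count 7/3, vertices of \<open>Q\<close> must be inactive. A tie earns neither the
  bonus \<open>4/3\<close> nor inactivity.\<close>

definition side_weight :: "'a set \<Rightarrow> 'a set \<Rightarrow> ('a \<Rightarrow> 'a set) \<Rightarrow> ('a \<Rightarrow> nat) \<Rightarrow> real" where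
  "side_weight P Q nb t = (\<Prod>v\<in>P. 1 + 4/3 * of_bool (\<forall>w\<in>nb v. t w < t v)) *
    (\<Prod>w\<in>Q. of_bool (\<exists>v\<in>nb w. t w < t v))"

text \<open>\<open>L\<close> is a choice of leaves whose centres lie outside it. The condition
  \<open>core\<close> gives each remaining vertex an attached leaf or two other neighbours, which is
  the case distinction \<open>k \<ge> 1 \<or> m \<ge> 2\<close> of the factor estimates.\<close>

locale bipartite_with_leaves =
  fixes P Q L :: "'a set" and nb :: "'a \<Rightarrow> 'a set"
  assumes fin: "finite P" "finite Q"
    and disj: "P \<inter> Q = {}"
    and nb_P: "\<And>v. v \<in> P \<Longrightarrow> nb v \<subseteq> Q"
    and nb_Q: "\<And>v. v \<in> Q \<Longrightarrow> nb v \<subseteq> P"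
    and nb_sym: "\<And>v w. v \<in> P \<union> Q \<Longrightarrow> w \<in> nb v \<Longrightarrow> v \<in> nb w"
    and L_subset: "L \<subseteq> P \<union> Q"
    and leaf: "\<And>l. l \<in> L \<Longrightarrow> \<exists>c. nb l = {c} \<and> c \<notin> L"
    and core: "\<And>u. u \<in> (P \<union> Q) - L \<Longrightarrow> nb u \<inter> L \<noteq> {} \<or> card (nb u) \<ge> 2"
begin

text \<open>The factors of \<open>side_weight\<close> belonging to \<open>u\<close> and to its
  leaves. A leaf has \<open>u\<close> as its only neighbour, so its activity is one comparison. For
  \<open>u\<close> in \<open>P\<close> the leaf factors already force \<open>u\<close> above its
  leaves, hence the bonus tests only the other neighbours.\<close>

definition core_weight :: "'a \<Rightarrow> ('a \<Rightarrow> nat) \<Rightarrow> real" where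
  "core_weight u t =
    (if u \<in> P
     then (\<Prod>l\<in>nb u \<inter> L. of_bool (t l < t u)) * (1 + 4/3 * (\<Prod>w\<in>nb u - L. of_bool (t w < t u)))
     else (\<Prod>l\<in>nb u \<inter> L. 1 + 4/3 * of_bool (t u < t l)) * of_bool (\<exists>v\<in>nb u. t u < t v))"

lemma nb_finite: "v \<in> P \<union> Q \<Longrightarrow> finite (nb v)"
  using nb_P nb_Q fin by (meson UnE finite_subset)

lemma leaf_nb: "u \<in> P \<union> Q \<Longrightarrow> l \<in> nb u \<inter> L \<Longrightarrow> nb l = {u}"
  using leaf[of l] nb_sym[of u l] by auto

text \<open>The sets \<open>nb u \<inter> L\<close>, for \<open>u\<close> outside \<open>L\<close>,
  partition \<open>L\<close>, because every leaf has exactly one neighbour and that neighbour is not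
  in \<open>L\<close>.\<close>

lemma side_weight_eq: "side_weight P Q nb t = (\<Prod>u\<in>(P \<union> Q) - L. core_weight u t)"
proof -
  define \<phi> :: "'a \<Rightarrow> real" where "\<phi> v = (if v \<in> P then 1 + 4/3 * of_bool (\<forall>w\<in>nb v. t w < t v)
      else of_bool (\<exists>w\<in>nb v. t v < t w))" for v
  have "side_weight P Q nb t = (\<Prod>v\<in>P. \<phi> v) * (\<Prod>v\<in>Q. \<phi> v)"
    unfolding side_weight_def \<phi>_def using disj by (intro arg_cong2[of _ _ _ _ "(*)"] prod.cong) auto
  also have "\<dots> = (\<Prod>v\<in>P \<union> Q. \<phi> v)" using fin disj by (simp add: prod.union_disjoint)
  also have "\<dots> = (\<Prod>v\<in>(P \<union> Q) - L. \<phi> v) * (\<Prod>v\<in>L. \<phi> v)"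
    using fin L_subset by (intro prod.subset_diff) auto
  also have "(\<Prod>v\<in>L. \<phi> v) = (\<Prod>u\<in>(P \<union> Q) - L. \<Prod>v\<in>nb u \<inter> L. \<phi> v)"
  proof -
    have "L \<subseteq> (\<Union>u\<in>(P \<union> Q) - L. nb u \<inter> L)"
    proof
      fix l assume l: "l \<in> L"
      then obtain c where c: "nb l = {c}" "c \<notin> L" using leaf by blast
      have "l \<in> P \<union> Q" using l L_subset by blast
      then have "c \<in> P \<union> Q" "l \<in> nb c" using nb_sym[of l c] nb_P[of l] nb_Q[of l] c by auto
      then show "l \<in> (\<Union>u\<in>(P \<union> Q) - L. nb u \<inter> L)" using l c by blast
    qed
    then have "(\<Union>u\<in>(P \<union> Q) - L. nb u \<inter> L) = L" by blast
    moreover have "\<forall>i\<in>P \<union> Q - L. \<forall>j\<in>P \<union> Q - L. i \<noteq> j \<longrightarrow> nb i \<inter> L \<inter> (nb j \<inter> L) = {}"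
    proof (intro ballI impI)
      fix i j assume ij: "i \<in> P \<union> Q - L" "j \<in> P \<union> Q - L" "i \<noteq> j"
      have "i = j" if "l \<in> nb i \<inter> L" "l \<in> nb j \<inter> L" for l
        using leaf_nb[of i l] leaf_nb[of j l] that ij by simp
      then show "nb i \<inter> L \<inter> (nb j \<inter> L) = {}" using ij(3) by blast
    qed
    moreover have "finite (P \<union> Q - L)" "\<forall>u\<in>P \<union> Q - L. finite (nb u \<inter> L)"
      using fin nb_finite by auto
    ultimately show ?thesis
      using prod.UNION_disjoint[of "P \<union> Q - L" "\<lambda>u. nb u \<inter> L" \<phi>] by simp
  qed
  also have "(\<Prod>v\<in>(P \<union> Q) - L. \<phi> v) * (\<Prod>u\<in>(P \<union> Q) - L. \<Prod>v\<in>nb u \<inter> L. \<phi> v)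
      = (\<Prod>u\<in>(P \<union> Q) - L. core_weight u t)"
    unfolding prod.distrib[symmetric]
  proof (rule prod.cong[OF refl])
    fix u assume u: "u \<in> (P \<union> Q) - L"
    then have nbf: "finite (nb u)" using nb_finite by blast
    have nbl: "nb l = {u}" if "l \<in> nb u \<inter> L" for l using leaf_nb u that by blast
    show "\<phi> u * (\<Prod>v\<in>nb u \<inter> L. \<phi> v) = core_weight u t"
    proof (cases "u \<in> P")
      case True
      have leaves: "(\<Prod>v\<in>nb u \<inter> L. \<phi> v) = (\<Prod>l\<in>nb u \<inter> L. of_bool (t l < t u))"
        using nbl nb_P[OF True] disj by (intro prod.cong) (auto simp: \<phi>_def)
      show ?thesis
      proof (cases "\<forall>l\<in>nb u \<inter> L. t l < t u")
        case all: True
        then have "(\<forall>w\<in>nb u. t w < t u) \<longleftrightarrow> (\<forall>w\<in>nb u - L. t w < t u)" by blast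
        then show ?thesis
          unfolding leaves using True nbf by (simp add: \<phi>_def core_weight_def prod_of_bool_all mult.commute)
      next
        case False
        then show ?thesis
          unfolding leaves using True nbf by (simp add: core_weight_def prod_of_bool_all)
      qed
    next
      case False
      then have "u \<in> Q" using u by blast
      then have "(\<Prod>v\<in>nb u \<inter> L. \<phi> v) = (\<Prod>l\<in>nb u \<inter> L. 1 + 4/3 * of_bool (t u < t l))"
        using nbl nb_Q by (intro prod.cong) (auto simp: \<phi>_def)
      then show ?thesis using False by (simp add: core_weight_def \<phi>_def)
    qed
  qed
  finally show ?thesis .
qed

lemma core_weight_nonneg: "0 \<le> core_weight u t"
  unfolding core_weight_def by (auto intro!: mult_nonneg_nonneg prod_nonneg add_nonneg_nonneg)

text \<open>Raising values on \<open>P\<close> and lowering them on \<open>Q\<close> preserves every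
  relation \<open>t w < t v\<close> with \<open>v\<close> in \<open>P\<close> and \<open>w\<close>
  in \<open>Q\<close>, and all group weights increase with these relations.\<close>

definition side_le :: "'a \<Rightarrow> nat \<Rightarrow> nat \<Rightarrow> bool" where
  "side_le v x y = (if v \<in> P then x \<le> y else y \<le> x)"

lemma core_weight_mono:
  assumes u: "u \<in> P \<union> Q"
  shows "coordinatewise_mono (P \<union> Q) side_le (core_weight u)"
  unfolding coordinatewise_mono_def
proof (intro allI impI)
  fix s t assume st: "\<forall>v\<in>P \<union> Q. side_le v (s v) (t v)"
  have P: "s v \<le> t v" if "v \<in> P" for v using st that by (auto simp: side_le_def)
  have Q: "t v \<le> s v" if "v \<in> Q" for v
  proof -
    have "v \<notin> P" using that disj by blast
    then show ?thesis using st that by (simp add: side_le_def)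
  qed
  show "core_weight u s \<le> core_weight u t"
  proof (cases "u \<in> P")
    case True
    have "t w < t u" if "w \<in> nb u" "s w < s u" for w
      using P[OF True] Q[of w] nb_P[OF True] that by fastforce
    then have *: "of_bool (s w < s u) \<le> (of_bool (t w < t u) :: real)" if "w \<in> nb u" for w
      using that by (simp add: of_bool_def)
    show ?thesis unfolding core_weight_def if_P[OF True]
      by (intro mult_mono add_left_mono mult_left_mono prod_mono)
        (use * in \<open>auto intro!: add_nonneg_nonneg prod_nonneg\<close>)
  next
    case False
    then have uQ: "u \<in> Q" using u by blast
    have up: "t u < t w" if "w \<in> nb u" "s u < s w" for w
      using Q[OF uQ] P[of w] nb_Q[OF uQ] that by fastforce
    then have *: "of_bool (s u < s w) \<le> (of_bool (t u < t w) :: real)" if "w \<in> nb u" for w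
      using that by (simp add: of_bool_def)
    have **: "of_bool (\<exists>v\<in>nb u. s u < s v) \<le> (of_bool (\<exists>v\<in>nb u. t u < t v) :: real)"
      using up by (auto simp: of_bool_def)
    show ?thesis unfolding core_weight_def if_not_P[OF False]
      by (intro mult_mono ** prod_mono conjI add_left_mono mult_left_mono)
        (use * in \<open>auto intro!: prod_nonneg\<close>)
  qed
qed

text \<open>The uniform grid distribution, conditioned for the vertices of \<open>Q\<close> outside
  \<open>L\<close> on values below the cutoff 4/5.\<close>

definition capped :: "nat \<Rightarrow> 'a \<Rightarrow> nat \<Rightarrow> real" where
  "capped n v x = (if v \<in> Q - L then of_bool (x < 4*n) / real (4*n) else 1 / real (5*n))"

context
  fixes n :: nat
  assumes n: "n > 0"
begin

section \<open>Expected group weights under capped values\<close>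

lemma capped_tail:
  assumes "x < 5*n"
  shows "(\<Sum>y<5*n. capped n v y * of_bool (y < x))
    = (if v \<in> Q - L then min (real x / real (4*n)) 1 else real x / real (5*n))"
proof (cases "v \<in> Q - L")
  case True
  have "(\<Sum>y<5*n. capped n v y * of_bool (y < x)) = (\<Sum>y<5*n. of_bool (y < min x (4*n))) / real (4*n)"
    unfolding sum_divide_distrib using True by (intro sum.cong) (auto simp: capped_def)
  also have "\<dots> = real (min x (4*n)) / real (4*n)" by (subst sum_of_bool_less) auto
  also have "\<dots> = min (real x / real (4*n)) 1" using n by (auto simp: min_def field_simps)
  finally show ?thesis using True by simp
next
  case False
  have "(\<Sum>y<5*n. capped n v y * of_bool (y < x)) = (\<Sum>y<5*n. of_bool (y < x)) / real (5*n)"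
    unfolding sum_divide_distrib using False by (intro sum.cong) (auto simp: capped_def)
  also have "\<dots> = real x / real (5*n)" using assms by (subst sum_of_bool_less) auto
  finally show ?thesis by (simp only: False if_False)
qed

lemma capped_distribution: "product_distribution (P \<union> Q) {..<5*n} (capped n) side_le"
proof
  fix v assume "v \<in> P \<union> Q"
  show "(\<Sum>x<5*n. capped n v x) = 1"
  proof (cases "v \<in> Q - L")
    case True
    then have "(\<Sum>x<5*n. capped n v x) = (\<Sum>x<5*n. of_bool (x < 4*n)) / real (4*n)"
      unfolding sum_divide_distrib by (intro sum.cong) (auto simp: capped_def)
    also have "\<dots> = 1" using n by (subst sum_of_bool_less) auto
    finally show ?thesis .
  next
    case False
    then have "capped n v x = 1 / real (5*n)" for x unfolding capped_def by (rule if_not_P)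
    then show ?thesis using n by simp
  qed
qed (use fin in \<open>auto simp: capped_def side_le_def\<close>)

interpretation capped: product_distribution "P \<union> Q" "{..<5*n}" "capped n" side_le
  by (rule capped_distribution)

abbreviation "leaf_deg u \<equiv> card (nb u \<inter> L)"
abbreviation "core_deg u \<equiv> card (nb u - L)"

text \<open>Given \<open>t u = x\<close>, a leaf is smaller with probability
  \<open>x / (5*n)\<close> and any other neighbour, being capped, with probability
  \<open>min (x / (4*n)) 1\<close>, all independently.\<close>

lemma expectation_core_weight_P:
  assumes u: "u \<in> P - L"
  shows "expectation_on (P \<union> Q) {..<5*n} (capped n) (core_weight u)
    = active_factor n (leaf_deg u) (core_deg u)"
proof -
  have uV: "u \<in> P \<union> Q" and uP: "u \<in> P" using u by auto
  have nbQ: "nb u \<subseteq> Q" using nb_P[OF uP] .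
  then have W: "nb u \<inter> L \<subseteq> P \<union> Q - {u}" "nb u \<subseteq> P \<union> Q - {u}" using uP disj by auto
  have nbf: "finite (nb u)" using nb_finite uV by blast
  have split: "(\<Prod>w\<in>nb u. h w) = (\<Prod>w\<in>nb u \<inter> L. h w) * (\<Prod>w\<in>nb u - L. h w)" for h :: "'a \<Rightarrow> real"
    using prod.Int_Diff[OF nbf] .
  have "core_weight u = (\<lambda>t. (\<Prod>l\<in>nb u \<inter> L. of_bool (t l < t u))
      + 4/3 * (\<Prod>w\<in>nb u. of_bool (t w < t u)))"
    using uP by (intro ext) (simp add: core_weight_def split algebra_simps)
  then have "expectation_on (P \<union> Q) {..<5*n} (capped n) (core_weight u)
    = (\<Sum>x<5*n. capped n u x * (\<Prod>v\<in>nb u \<inter> L. \<Sum>y<5*n. capped n v y * of_bool (y < x)))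
      + 4/3 * (\<Sum>x<5*n. capped n u x * (\<Prod>v\<in>nb u. \<Sum>y<5*n. capped n v y * of_bool (y < x)))"
    using capped.expectation_on_star[OF uV W(1), of "\<lambda>_. 1" "\<lambda>v y x. of_bool (y < x)"]
      capped.expectation_on_star[OF uV W(2), of "\<lambda>_. 1" "\<lambda>v y x. of_bool (y < x)"]
    by (simp only: expectation_on_add expectation_on_cmult mult_1)
  also have "\<dots> = (\<Sum>x<5*n. 1 / real (5*n) * (real x / real (5*n)) ^ leaf_deg u)
      + 4/3 * (\<Sum>x<5*n. 1 / real (5*n) * ((real x / real (5*n)) ^ leaf_deg u
          * (min (real x / real (4*n)) 1) ^ core_deg u))"
  proof (intro arg_cong2[of _ _ _ _ "(+)"] arg_cong2[of _ _ _ _ "(*)"] sum.cong refl)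
    fix x assume "x \<in> {..<5*n}"
    then have x: "x < 5*n" by simp
    have leaves: "(\<Prod>v\<in>nb u \<inter> L. \<Sum>y<5*n. capped n v y * of_bool (y < x))
        = (real x / real (5*n)) ^ leaf_deg u"
      by (simp add: capped_tail[OF x])
    moreover have "(\<Prod>v\<in>nb u - L. \<Sum>y<5*n. capped n v y * of_bool (y < x))
        = (\<Prod>v\<in>nb u - L. min (real x / real (4*n)) 1)"
      using nbQ by (intro prod.cong refl) (auto simp: capped_tail[OF x])
    ultimately show "(\<Prod>v\<in>nb u. \<Sum>y<5*n. capped n v y * of_bool (y < x))
        = (real x / real (5*n)) ^ leaf_deg u * (min (real x / real (4*n)) 1) ^ core_deg u"
      by (simp only: split prod_constant)
    show "(\<Prod>v\<in>nb u \<inter> L. \<Sum>y<5*n. capped n v y * of_bool (y < x))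
        = (real x / real (5*n)) ^ leaf_deg u" by (rule leaves)
    show "capped n u x = 1 / real (5*n)" "capped n u x = 1 / real (5*n)"
      using uP disj by (auto simp: capped_def)
  qed
  also have "\<dots> = active_factor n (leaf_deg u) (core_deg u)"
    unfolding active_factor_def sum_distrib_left sum.distrib[symmetric]
    by (intro sum.cong refl) (simp add: algebra_simps)
  finally show ?thesis .
qed

lemma expectation_core_weight_Q:
  assumes u: "u \<in> Q - L"
  shows "expectation_on (P \<union> Q) {..<5*n} (capped n) (core_weight u)
    = inactive_factor n (leaf_deg u) (core_deg u)"
proof -
  have uV: "u \<in> P \<union> Q" and uQ: "u \<in> Q" and uP: "u \<notin> P" using u disj by auto
  have nbP: "nb u \<subseteq> P" using nb_Q[OF uQ] .
  then have W: "nb u \<inter> L \<subseteq> P \<union> Q - {u}" "nb u \<subseteq> P \<union> Q - {u}" using uP by auto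
  have nbf: "finite (nb u)" using nb_finite uV by blast
  \<comment> \<open>If no neighbour exceeds \<open>u\<close>, all leaf factors are 1; so restricting
    to the opposite event amounts to subtracting an indicator, which is again a product over the
    star. Writing it with \<open>Suc\<close> turns \<open>\<le>\<close> into the strict comparison
    of \<open>capped_tail\<close>.\<close>
  have "core_weight u = (\<lambda>t. (\<Prod>l\<in>nb u \<inter> L. 1 + 4/3 * of_bool (t u < t l))
      - (\<Prod>w\<in>nb u. of_bool (t w < Suc (t u))))"
  proof
    fix t
    show "core_weight u t = (\<Prod>l\<in>nb u \<inter> L. 1 + 4/3 * of_bool (t u < t l))
      - (\<Prod>w\<in>nb u. of_bool (t w < Suc (t u)))"
    proof (cases "\<exists>v\<in>nb u. t u < t v")
      case True
      then have "\<not> (\<forall>w\<in>nb u. t w < Suc (t u))" by (meson not_less_eq)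
      then show ?thesis using True uP nbf by (simp add: core_weight_def prod_of_bool_all)
    next
      case False
      then have "\<forall>w\<in>nb u. t w < Suc (t u)" by auto
      moreover have "(\<Prod>l\<in>nb u \<inter> L. 1 + 4/3 * of_bool (t u < t l)) = (1::real)"
        using False by (intro prod.neutral) auto
      ultimately show ?thesis using False uP nbf by (simp add: core_weight_def prod_of_bool_all)
    qed
  qed
  then have "expectation_on (P \<union> Q) {..<5*n} (capped n) (core_weight u)
    = (\<Sum>x<5*n. capped n u x *
        (\<Prod>v\<in>nb u \<inter> L. \<Sum>y<5*n. capped n v y * (1 + 4/3 * of_bool (x < y))))
      - (\<Sum>x<5*n. capped n u x * (\<Prod>v\<in>nb u. \<Sum>y<5*n. capped n v y * of_bool (y < Suc x)))"
    using capped.expectation_on_star[OF uV W(1), of "\<lambda>_. 1" "\<lambda>v y x. 1 + 4/3 * of_bool (x < y)"]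
      capped.expectation_on_star[OF uV W(2), of "\<lambda>_. 1" "\<lambda>v y x. of_bool (y < Suc x)"]
    by (simp only: expectation_on_diff mult_1)
  also have "\<dots> = (\<Sum>x<5*n. capped n u x *
        ((\<Prod>v\<in>nb u \<inter> L. \<Sum>y<5*n. capped n v y * (1 + 4/3 * of_bool (x < y)))
          - (\<Prod>v\<in>nb u. \<Sum>y<5*n. capped n v y * of_bool (y < Suc x))))"
    by (simp add: right_diff_distrib sum_subtractf)
  \<comment> \<open>The weight of the capped vertex \<open>u\<close> vanishes from
    \<open>4*n\<close> on.\<close>
  also have "\<dots> = (\<Sum>x<4*n. capped n u x *
        ((\<Prod>v\<in>nb u \<inter> L. \<Sum>y<5*n. capped n v y * (1 + 4/3 * of_bool (x < y)))
          - (\<Prod>v\<in>nb u. \<Sum>y<5*n. capped n v y * of_bool (y < Suc x))))"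
    by (rule sum.mono_neutral_right) (use u in \<open>auto simp: capped_def\<close>)
  also have "\<dots> = inactive_factor n (leaf_deg u) (core_deg u)"
    unfolding inactive_factor_def
  proof (intro sum.cong refl arg_cong2[of _ _ _ _ "(*)"] arg_cong2[of _ _ _ _ "(-)"])
    fix x assume "x \<in> {..<4*n}"
    then have x: "x < 4*n" "x < 5*n" by simp_all
    show "capped n u x = 1 / real (4*n)" using u x by (simp add: capped_def)
    have le: "(\<Sum>y<5*n. capped n v y * of_bool (y < Suc x)) = real (x + 1) / real (5*n)"
      if "v \<in> nb u" for v
    proof -
      have v: "v \<notin> Q - L" using that nbP disj by blast
      have "Suc x < 5*n" using x n by linarith
      show ?thesis using capped_tail[OF \<open>Suc x < 5*n\<close>, of v]
        by (simp only: v if_False Suc_eq_plus1)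
    qed
    have "(\<Prod>v\<in>nb u. \<Sum>y<5*n. capped n v y * of_bool (y < Suc x)) = (real (x + 1) / real (5*n)) ^ card (nb u)"
      using le by simp
    also have "card (nb u) = leaf_deg u + core_deg u"
      using card_Int_Diff[OF nbf] .
    finally show "(\<Prod>v\<in>nb u. \<Sum>y<5*n. capped n v y * of_bool (y < Suc x))
      = (real (x + 1) / real (5*n)) ^ (leaf_deg u + core_deg u)" .
    have "(\<Sum>y<5*n. capped n v y * (1 + 4/3 * of_bool (x < y)))
      = 1 + 4/3 * (1 - real (x + 1) / real (5*n))" if v: "v \<in> nb u \<inter> L" for v
    proof -
      have "v \<in> P \<union> Q" using v nbP by blast
      have "(\<Sum>y<5*n. capped n v y * (1 + 4/3 * of_bool (x < y)))
        = (\<Sum>y<5*n. capped n v y * (1 + 4/3)) - (\<Sum>y<5*n. 4/3 * (capped n v y * of_bool (y < Suc x)))"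
        unfolding sum_subtractf[symmetric] by (intro sum.cong) (auto simp: algebra_simps)
      also have "\<dots> = (1 + 4/3) - 4/3 * (real (x + 1) / real (5*n))"
        using capped.total[OF \<open>v \<in> P \<union> Q\<close>] le[of v] v
        by (simp only: sum_distrib_right[symmetric] sum_distrib_left[symmetric]) simp
      finally show ?thesis by (simp add: algebra_simps)
    qed
    then show "(\<Prod>v\<in>nb u \<inter> L. \<Sum>y<5*n. capped n v y * (1 + 4/3 * of_bool (x < y)))
      = (1 + 4/3 * (1 - real (x + 1) / real (5*n))) ^ leaf_deg u" by simp
  qed
  finally show ?thesis .
qed

text \<open>Harris' inequality separates the groups under the capped distribution; returning to the
  uniform one costs 4/5 for each capped vertex, since
  \<open>4/5 * (1 / (4*n)) = 1 / (5*n)\<close>.\<close>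

lemma expectation_side_weight_ge:
  "(\<Prod>u\<in>P - L. active_factor n (leaf_deg u) (core_deg u)) *
    (\<Prod>u\<in>Q - L. 4/5 * inactive_factor n (leaf_deg u) (core_deg u))
   \<le> expectation_on (P \<union> Q) {..<5*n} (\<lambda>_ _. 1 / real (5*n)) (side_weight P Q nb)"
proof -
  let ?E = "expectation_on (P \<union> Q) {..<5*n} (capped n)"
  have PQ: "(P \<union> Q) - L = (P - L) \<union> (Q - L)" by blast
  define c :: "'a \<Rightarrow> real" where "c v = (if v \<in> Q - L then 4/5 else 1)" for v
  have c: "(\<Prod>v\<in>P \<union> Q. c v) = (\<Prod>u\<in>Q - L. 4/5)"
    unfolding c_def using prod.inter_restrict[of "P \<union> Q" "\<lambda>_. 4/5 :: real" "Q - L"] fin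
    by (simp add: Int_absorb1 le_supI2)
  have "(\<Prod>u\<in>P - L. active_factor n (leaf_deg u) (core_deg u)) *
    (\<Prod>u\<in>Q - L. inactive_factor n (leaf_deg u) (core_deg u))
    = (\<Prod>u\<in>P - L. ?E (core_weight u)) * (\<Prod>u\<in>Q - L. ?E (core_weight u))"
    by (simp add: expectation_core_weight_P expectation_core_weight_Q)
  also have "\<dots> = (\<Prod>u\<in>(P \<union> Q) - L. ?E (core_weight u))"
    unfolding PQ using fin disj by (subst prod.union_disjoint) auto
  also have "\<dots> \<le> ?E (\<lambda>t. \<Prod>u\<in>(P \<union> Q) - L. core_weight u t)"
    using fin core_weight_mono core_weight_nonneg by (intro capped.harris_inequality_prod) auto
  also have "(\<lambda>t. \<Prod>u\<in>(P \<union> Q) - L. core_weight u t) = side_weight P Q nb"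
    by (simp add: side_weight_eq fun_eq_iff)
  finally have "(\<Prod>v\<in>P \<union> Q. c v) * ((\<Prod>u\<in>P - L. active_factor n (leaf_deg u) (core_deg u)) *
    (\<Prod>u\<in>Q - L. inactive_factor n (leaf_deg u) (core_deg u)))
    \<le> (\<Prod>v\<in>P \<union> Q. c v) * ?E (side_weight P Q nb)"
    unfolding c by (rule mult_left_mono) simp
  also have "\<dots> \<le> expectation_on (P \<union> Q) {..<5*n} (\<lambda>_ _. 1 / real (5*n)) (side_weight P Q nb)"
  proof (rule expectation_on_scale)
    fix v :: 'a and x :: nat
    show "0 \<le> c v * capped n v x" "c v * capped n v x \<le> 1 / real (5*n)"
      using n by (auto simp: c_def capped_def)
    show "0 \<le> side_weight P Q nb t" for t
      unfolding side_weight_eq by (intro prod_nonneg) (auto simp: core_weight_nonneg)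
  qed
  finally show ?thesis unfolding c prod.distrib by (simp only: mult_ac)
qed

end

end

lemma bipartite_with_leaves_swap:
  assumes "bipartite_with_leaves P Q L nb"
  shows "bipartite_with_leaves Q P L nb"
proof -
  interpret bipartite_with_leaves P Q L nb by fact
  show ?thesis
    by unfold_locales (use fin disj nb_P nb_Q nb_sym L_subset leaf core in \<open>auto simp: Un_commute\<close>)
qed

text \<open>After multiplying the bounds for both assignments of the two sides, each vertex outside
  \<open>L\<close> occurs once with its active and once with its inactive factor.\<close>

lemma expectation_side_weight_product:
  assumes bip: "bipartite_with_leaves P Q L nb" and n: "n > 0"
    and ge: "\<And>k m. k \<le> card (P \<union> Q) \<Longrightarrow> m \<le> card (P \<union> Q) \<Longrightarrow> k \<ge> 1 \<or> m \<ge> 2 \<Longrightarrow>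
      4/5 * active_factor n k m * inactive_factor n k m \<ge> 1"
  shows "expectation_on (P \<union> Q) {..<5*n} (\<lambda>_ _. 1 / real (5*n)) (side_weight P Q nb) *
    expectation_on (P \<union> Q) {..<5*n} (\<lambda>_ _. 1 / real (5*n)) (side_weight Q P nb) \<ge> 1"
proof -
  interpret bipartite_with_leaves P Q L nb by fact
  interpret swap: bipartite_with_leaves Q P L nb by (rule bipartite_with_leaves_swap[OF bip])
  define A where "A u = active_factor n (card (nb u \<inter> L)) (card (nb u - L))" for u
  define I where "I u = 4/5 * inactive_factor n (card (nb u \<inter> L)) (card (nb u - L))" for u
  have A: "0 \<le> A u" for u
    unfolding A_def active_factor_def by (intro sum_nonneg mult_nonneg_nonneg) auto
  have AI: "1 \<le> A u * I u" if u: "u \<in> (P \<union> Q) - L" for u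
  proof -
    have nbf: "finite (nb u)" using nb_finite u by blast
    have "nb u \<subseteq> P \<union> Q" using nb_P nb_Q u by blast
    then have "card (nb u \<inter> L) \<le> card (P \<union> Q)" "card (nb u - L) \<le> card (P \<union> Q)"
      using fin by (auto intro!: card_mono)
    moreover have "card (nb u \<inter> L) \<ge> 1 \<or> card (nb u - L) \<ge> 2"
      using core[OF u] card_Int_Diff[OF nbf, of L] nbf
      by (cases "nb u \<inter> L = {}") (auto simp: Suc_le_eq card_gt_0_iff)
    ultimately show ?thesis using ge unfolding A_def I_def by (simp add: mult_ac)
  qed
  \<comment> \<open>The inactive factor is a difference, so its sign is read off from
    \<open>A u \<ge> 0\<close> and \<open>A u * I u \<ge> 1\<close>.\<close>
  have I: "0 \<le> I u" if "u \<in> (P \<union> Q) - L" for u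
  proof (rule ccontr)
    assume "\<not> 0 \<le> I u"
    then have "A u * I u \<le> 0" using A[of u] by (intro mult_nonneg_nonpos) auto
    then show False using AI[OF that] by simp
  qed
  have 1: "(\<Prod>u\<in>P - L. A u) * (\<Prod>u\<in>Q - L. I u)
    \<le> expectation_on (P \<union> Q) {..<5*n} (\<lambda>_ _. 1 / real (5*n)) (side_weight P Q nb)"
    unfolding A_def I_def by (rule expectation_side_weight_ge[OF n])
  have 2: "(\<Prod>u\<in>Q - L. A u) * (\<Prod>u\<in>P - L. I u)
    \<le> expectation_on (P \<union> Q) {..<5*n} (\<lambda>_ _. 1 / real (5*n)) (side_weight Q P nb)"
    unfolding A_def I_def using swap.expectation_side_weight_ge[OF n] by (simp add: Un_commute)
  have nn: "0 \<le> (\<Prod>u\<in>P - L. A u) * (\<Prod>u\<in>Q - L. I u)" "0 \<le> (\<Prod>u\<in>Q - L. A u) * (\<Prod>u\<in>P - L. I u)"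
    using A I by (auto intro!: mult_nonneg_nonneg prod_nonneg)
  have "1 \<le> (\<Prod>u\<in>P - L. A u * I u) * (\<Prod>u\<in>Q - L. A u * I u)"
  proof -
    have a: "1 \<le> (\<Prod>u\<in>P - L. A u * I u)" and b: "1 \<le> (\<Prod>u\<in>Q - L. A u * I u)"
      by (intro prod_ge_1; rule AI; blast)+
    show ?thesis using mult_mono[OF a b] a by simp
  qed
  also have "\<dots> = ((\<Prod>u\<in>P - L. A u) * (\<Prod>u\<in>Q - L. I u)) * ((\<Prod>u\<in>Q - L. A u) * (\<Prod>u\<in>P - L. I u))"
    by (simp add: prod.distrib mult_ac)
  also have "\<dots> \<le> expectation_on (P \<union> Q) {..<5*n} (\<lambda>_ _. 1 / real (5*n)) (side_weight P Q nb) *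
    expectation_on (P \<union> Q) {..<5*n} (\<lambda>_ _. 1 / real (5*n)) (side_weight Q P nb)"
    by (rule mult_mono[OF 1 2 order_trans[OF nn(1) 1] nn(2)])
  finally show ?thesis .
qed

section \<open>From group estimates to the Tutte polynomial\<close>

context matroid
begin

text \<open>Ties are broken lexicographically: scale \<open>t\<close> by \<open>N\<close> and add an
  injective numbering of \<open>E\<close> with values below \<open>N\<close>.\<close>

lemma refine_to_injective:
  fixes t :: "'a \<Rightarrow> nat"
  obtains t' :: "'a \<Rightarrow> nat" where "inj_on t' E" "\<And>v w. v \<in> E \<Longrightarrow> w \<in> E \<Longrightarrow> t w < t v \<Longrightarrow> t' w < t' v"
proof -
  obtain f :: "'a \<Rightarrow> nat" and N where f: "f ` E = {i. i < N}" "inj_on f E"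
    using finite_imp_inj_to_nat_seg[OF finite_ground] by blast
  define t' where "t' v = t v * N + f v" for v
  have less: "t' w < t' v" if "v \<in> E" "w \<in> E" "t w < t v" for v w
  proof -
    have "f w < N" using f(1) that(2) by blast
    then have "t' w < Suc (t w) * N" by (simp add: t'_def)
    also have "\<dots> \<le> t v * N" using that(3) by (intro mult_le_mono1) simp
    also have "\<dots> \<le> t' v" by (simp add: t'_def)
    finally show ?thesis .
  qed
  have "inj_on t' E"
  proof (rule inj_onI)
    fix v w assume vw: "v \<in> E" "w \<in> E" "t' v = t' w"
    then have "t v = t w" using less[of v w] less[of w v] by (metis less_irrefl linorder_neqE_nat)
    then show "v = w" using vw inj_onD[OF f(2), of v w] by (simp add: t'_def)
  qed
  then show thesis using that less by blast
qed

lemma exch_nbrs_subset: "matroid_basis indep B \<Longrightarrow> exch_nbrs E indep B u \<subseteq> E"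
  using basis_subset by (auto simp: exch_nbrs_def)

text \<open>The comparison is made factor by factor: a strict win or loss under \<open>t\<close>
  persists under \<open>t'\<close>, and at an undecided tie the left factor is 1 on \<open>P\<close>
  and 0 elsewhere, at most either possible right factor.\<close>

lemma side_weight_le_active_prod:
  assumes B: "matroid_basis indep B" and P: "P \<subseteq> E" and a: "a \<ge> 7/3"
    and refine: "\<And>v w. v \<in> E \<Longrightarrow> w \<in> E \<Longrightarrow> t w < t v \<Longrightarrow> t' w < (t' v :: nat)"
  shows "side_weight P (E - P) (exch_nbrs E indep B) t
    \<le> (\<Prod>u\<in>active E indep B t'. if u \<in> P then a else 0)"
proof -
  let ?nb = "exch_nbrs E indep B" and ?act = "active E indep B t'"
  have nbE: "w \<in> E" if "w \<in> ?nb u" for u w using exch_nbrs_subset[OF B] that by blast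
  have split: "(\<Prod>u\<in>E. g u) = (\<Prod>u\<in>P. g u) * (\<Prod>u\<in>E - P. g u)" for g :: "'a \<Rightarrow> real"
    using prod.subset_diff[OF P finite_ground, of g] by (simp add: mult.commute)
  have "side_weight P (E - P) ?nb t = (\<Prod>u\<in>E. if u \<in> P then 1 + 4/3 * of_bool (\<forall>w\<in>?nb u. t w < t u)
      else of_bool (\<exists>w\<in>?nb u. t u < t w))"
    unfolding side_weight_def split by (intro arg_cong2[of _ _ _ _ "(*)"] prod.cong) auto
  also have "\<dots> \<le> (\<Prod>u\<in>E. if u \<in> ?act then (if u \<in> P then a else 0) else 1)"
  proof (rule prod_mono)
    fix u assume u: "u \<in> E"
    have "u \<in> ?act" if "\<forall>w\<in>?nb u. t w < t u" using that u nbE refine by (auto simp: active_def)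
    moreover have "u \<notin> ?act" if "w \<in> ?nb u" "t u < t w" for w
      using refine[OF nbE[OF that(1)] u that(2)] that(1) by (force simp: active_def)
    ultimately show "(0::real) \<le> (if u \<in> P then 1 + 4/3 * of_bool (\<forall>w\<in>?nb u. t w < t u)
        else of_bool (\<exists>w\<in>?nb u. t u < t w)) \<and>
      (if u \<in> P then 1 + 4/3 * of_bool (\<forall>w\<in>?nb u. t w < t u)
        else of_bool (\<exists>w\<in>?nb u. t u < t w)) \<le> (if u \<in> ?act then (if u \<in> P then a else 0) else 1)"
      using a by (auto simp: of_bool_def)
  qed
  also have "\<dots> = (\<Prod>u\<in>E \<inter> ?act. if u \<in> P then a else 0)"
    using prod.inter_restrict[OF finite_ground, of "\<lambda>u. if u \<in> P then a else 0" ?act] by simp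
  also have "E \<inter> ?act = ?act" by (auto simp: active_def)
  finally show ?thesis .
qed

lemma tutte_ge_side_weight:
  assumes a: "a \<ge> 7/3"
  shows "(\<Sum>B | matroid_basis indep B. side_weight B (E - B) (exch_nbrs E indep B) t) \<le> tutte E indep a 0"
    and "(\<Sum>B | matroid_basis indep B. side_weight (E - B) B (exch_nbrs E indep B) t) \<le> tutte E indep 0 a"
proof -
  obtain t' :: "'a \<Rightarrow> nat" where inj: "inj_on t' E"
    and refine: "\<And>v w. v \<in> E \<Longrightarrow> w \<in> E \<Longrightarrow> t w < t v \<Longrightarrow> t' w < t' v"
    using refine_to_injective by blast
  show "(\<Sum>B | matroid_basis indep B. side_weight B (E - B) (exch_nbrs E indep B) t) \<le> tutte E indep a 0"
    unfolding tutte_activities[OF inj]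
    by (intro sum_mono side_weight_le_active_prod refine a) (auto dest: basis_subset)
  show "(\<Sum>B | matroid_basis indep B. side_weight (E - B) B (exch_nbrs E indep B) t) \<le> tutte E indep 0 a"
    unfolding tutte_activities[OF inj]
  proof (rule sum_mono)
    fix B assume "B \<in> {B. matroid_basis indep B}"
    then have B: "matroid_basis indep B" by simp
    have "E - (E - B) = B" using basis_subset[OF B] by blast
    moreover have "(\<Prod>u\<in>active E indep B t'. if u \<in> E - B then a else 0)
      = (\<Prod>u\<in>active E indep B t'. if u \<in> B then 0 else a)"
      by (intro prod.cong) (auto simp: active_def)
    ultimately show "side_weight (E - B) B (exch_nbrs E indep B) t
      \<le> (\<Prod>u\<in>active E indep B t'. if u \<in> B then 0 else a)"
      using side_weight_le_active_prod[of B "E - B" a t t', OF B _ a refine] by simp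
  qed
qed

text \<open>The Tutte values do not depend on \<open>t\<close>, so the bound for each
  \<open>t\<close> survives averaging, and the average commutes with the sum over bases.\<close>

lemma expectation_side_weight_le_tutte:
  assumes a: "a \<ge> 7/3" and n: "n > 0"
  shows "(\<Sum>B | matroid_basis indep B. expectation_on E {..<5*n} (\<lambda>_ _. 1 / real (5*n))
      (side_weight B (E - B) (exch_nbrs E indep B))) \<le> tutte E indep a 0"
    and "(\<Sum>B | matroid_basis indep B. expectation_on E {..<5*n} (\<lambda>_ _. 1 / real (5*n))
      (side_weight (E - B) B (exch_nbrs E indep B))) \<le> tutte E indep 0 a"
proof -
  interpret product_distribution E "{..<5*n}" "\<lambda>_ _. 1 / real (5*n)" "\<lambda>_. (\<le>)"
    by unfold_locales (use finite_ground n in auto)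
  have le: "(\<Sum>B\<in>\<B>. expectation_on E {..<5*n} (\<lambda>_ _. 1 / real (5*n)) (g B)) \<le> c"
    if "\<And>t. (\<Sum>B\<in>\<B>. g B t) \<le> c" for \<B> :: "'a set set" and g c
  proof -
    have "(\<Sum>B\<in>\<B>. expectation_on E {..<5*n} (\<lambda>_ _. 1 / real (5*n)) (g B))
      = expectation_on E {..<5*n} (\<lambda>_ _. 1 / real (5*n)) (\<lambda>t. \<Sum>B\<in>\<B>. g B t)"
      by (simp add: expectation_on_sum)
    also have "\<dots> \<le> expectation_on E {..<5*n} (\<lambda>_ _. 1 / real (5*n)) (\<lambda>_. c)"
      using that by (intro expectation_on_mono) auto
    finally show ?thesis by (simp only: expectation_on_const)
  qed
  show "(\<Sum>B | matroid_basis indep B. expectation_on E {..<5*n} (\<lambda>_ _. 1 / real (5*n))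
      (side_weight B (E - B) (exch_nbrs E indep B))) \<le> tutte E indep a 0"
    by (rule le) (rule tutte_ge_side_weight(1)[OF a])
  show "(\<Sum>B | matroid_basis indep B. expectation_on E {..<5*n} (\<lambda>_ _. 1 / real (5*n))
      (side_weight (E - B) B (exch_nbrs E indep B))) \<le> tutte E indep 0 a"
    by (rule le) (rule tutte_ge_side_weight(2)[OF a])
qed

text \<open>A component consisting of a single edge has two vertices of degree one; only the one outside
  \<open>B\<close> counts as a leaf.\<close>

definition exch_leaves :: "'a set \<Rightarrow> 'a set" where
  "exch_leaves B = {l \<in> E. card (exch_nbrs E indep B l) = 1 \<and>
    \<not> (l \<in> B \<and> (\<forall>w\<in>exch_nbrs E indep B l. card (exch_nbrs E indep B w) = 1))}"

text \<open>Absence of loops and coloops gives every vertex a neighbour. The asymmetric choice of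
  leaves keeps the centre of a leaf out of the leaf set, even in a single-edge component.\<close>

lemma exch_graph_bipartite:
  assumes B: "matroid_basis indep B"
    and nl: "\<And>e. \<not> matroid_loop E indep e" and nc: "\<And>e. \<not> matroid_coloop E indep e"
  shows "bipartite_with_leaves B (E - B) (exch_leaves B) (exch_nbrs E indep B)"
proof
  let ?nb = "exch_nbrs E indep B"
  have BE: "B \<subseteq> E" by (rule basis_subset[OF B])
  show "finite B" "finite (E - B)" using basis_finite[OF B] finite_ground by auto
  show "B \<inter> (E - B) = {}" by blast
  show "?nb v \<subseteq> E - B" if "v \<in> B" for v using that by (auto simp: exch_nbrs_def)
  show nbB: "?nb v \<subseteq> B" if "v \<in> E - B" for v using that by (auto simp: exch_nbrs_def)
  show sym: "v \<in> ?nb w" if "v \<in> B \<union> (E - B)" "w \<in> ?nb v" for v w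
    using exch_nbrs_sym[of v w B] that BE by blast
  show "exch_leaves B \<subseteq> B \<union> (E - B)" by (auto simp: exch_leaves_def)
  show "\<exists>c. ?nb l = {c} \<and> c \<notin> exch_leaves B" if l: "l \<in> exch_leaves B" for l
  proof -
    have lE: "l \<in> B \<union> (E - B)" using l by (auto simp: exch_leaves_def)
    obtain c where c: "?nb l = {c}"
      using l by (auto simp: exch_leaves_def card_1_singleton_iff)
    have lc: "l \<in> ?nb c" using sym[OF lE] c by blast
    have "c \<notin> exch_leaves B"
    proof
      assume cL: "c \<in> exch_leaves B"
      then have c1: "card (?nb c) = 1" by (simp add: exch_leaves_def)
      then have nc: "?nb c = {l}" using lc by (auto simp: card_1_singleton_iff)
      have "l \<notin> B" using l c c1 by (simp add: exch_leaves_def)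
      then have "c \<in> B" using nbB[of l] lE c by auto
      moreover have "card (?nb l) = 1" using c by simp
      ultimately show False using cL nc by (simp add: exch_leaves_def)
    qed
    then show ?thesis using c by blast
  qed
  show "?nb u \<inter> exch_leaves B \<noteq> {} \<or> 2 \<le> card (?nb u)" if u: "u \<in> B \<union> (E - B) - exch_leaves B" for u
  proof -
    have uE: "u \<in> E" using u BE by blast
    have "?nb u \<noteq> {}" using exch_nbrs_nonempty[OF B uE nl nc] .
    moreover have "finite (?nb u)" using exch_nbrs_subset[OF B] finite_ground finite_subset by blast
    ultimately have "card (?nb u) > 0" by (simp add: card_gt_0_iff)
    \<comment> \<open>A vertex of degree one that is not a chosen leaf is the end in
      \<open>B\<close> of a single-edge component, and the other end is a leaf.\<close>
    moreover have "?nb u \<inter> exch_leaves B \<noteq> {}" if 1: "card (?nb u) = 1"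
    proof -
      have uB: "u \<in> B" and all: "\<forall>w\<in>?nb u. card (?nb w) = 1"
        using u uE 1 by (auto simp: exch_leaves_def)
      obtain w where w: "w \<in> ?nb u" using \<open>?nb u \<noteq> {}\<close> by blast
      then have "w \<in> E - B" using uB by (auto simp: exch_nbrs_def)
      then have "w \<in> exch_leaves B" using all w by (simp add: exch_leaves_def)
      then show ?thesis using w by blast
    qed
    ultimately show ?thesis by linarith
  qed
qed

end

text \<open>Cauchy-Schwarz in pairwise form: by the inequality of arithmetic and geometric means,
  \<open>x i * y j + x j * y i\<close> is at least 2 for all \<open>i\<close> and
  \<open>j\<close>.\<close>

lemma sum_mult_sum_ge_card_square:
  fixes x y :: "'b \<Rightarrow> real"
  assumes I: "finite I" and pos: "\<And>i. i \<in> I \<Longrightarrow> 0 \<le> x i" "\<And>i. i \<in> I \<Longrightarrow> 0 \<le> y i"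
    and xy: "\<And>i. i \<in> I \<Longrightarrow> 1 \<le> x i * y i"
  shows "(real (card I))\<^sup>2 \<le> (\<Sum>i\<in>I. x i) * (\<Sum>i\<in>I. y i)"
proof -
  have two: "2 \<le> x i * y j + x j * y i" if "i \<in> I" "j \<in> I" for i j
  proof -
    have "1 \<le> (x i * y i) * (x j * y j)"
      using mult_mono[OF xy[OF that(1)] xy[OF that(2)]] xy[OF that(1)] by simp
    then have "2\<^sup>2 \<le> 4 * ((x i * y j) * (x j * y i))" by (simp add: mult_ac)
    also have "\<dots> \<le> (x i * y j + x j * y i)\<^sup>2"
      using zero_le_power2[of "x i * y j - x j * y i"] by (simp add: power2_eq_square algebra_simps)
    finally show ?thesis
      by (rule power2_le_imp_le) (use that pos in auto)
  qed
  have "2 * (real (card I))\<^sup>2 = (\<Sum>i\<in>I. \<Sum>j\<in>I. 2)" by (simp add: power2_eq_square)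
  also have "\<dots> \<le> (\<Sum>i\<in>I. \<Sum>j\<in>I. x i * y j + x j * y i)" by (intro sum_mono two)
  also have "\<dots> = (\<Sum>i\<in>I. \<Sum>j\<in>I. x i * y j) + (\<Sum>i\<in>I. \<Sum>j\<in>I. y i * x j)"
    by (simp add: sum.distrib mult.commute)
  also have "\<dots> = 2 * ((\<Sum>i\<in>I. x i) * (\<Sum>i\<in>I. y i))"
    unfolding sum_product[symmetric] by simp
  finally show ?thesis by simp
qed

theorem theorem1p3:
  fixes E :: "'a set" and indep :: "'a set \<Rightarrow> bool" and a :: real
  assumes "matroid E indep"
    and "\<And>e. \<not> matroid_loop E indep e"
    and "\<And>e. \<not> matroid_coloop E indep e"
    and "a \<ge> 2.355"
  shows "tutte E indep a 0 * tutte E indep 0 a \<ge> (tutte E indep 1 1)\<^sup>2"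
proof -
  interpret matroid E indep by fact
  have a: "a \<ge> 7/3" using assms(4) by simp
  let ?\<B> = "{B. matroid_basis indep B}"
  \<comment> \<open>Degrees in the exchange graphs are at most \<open>card E\<close>, so finitely
    many pairs occur and one grid size \<open>n\<close> serves all of them.\<close>
  let ?D = "{..card E} \<times> {..card E} \<inter> {(k, m). k \<ge> 1 \<or> m \<ge> 2}"
  have "\<forall>\<^sub>F n in sequentially. \<forall>(k, m)\<in>?D. 4/5 * active_factor n k m * inactive_factor n k m \<ge> 1"
    using eventually_factor_product_ge_1 by (intro eventually_ball_finite) auto
  then have "\<forall>\<^sub>F n in sequentially. n > 0 \<and>
      (\<forall>(k, m)\<in>?D. 4/5 * active_factor n k m * inactive_factor n k m \<ge> 1)"
    by (intro eventually_conj eventually_gt_at_top)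
  then obtain n where n: "n > 0"
    and ge: "\<forall>(k, m)\<in>?D. 4/5 * active_factor n k m * inactive_factor n k m \<ge> 1"
    using eventually_happens'[OF sequentially_bot] by blast
  let ?X = "\<lambda>B. expectation_on E {..<5*n} (\<lambda>_ _. 1 / real (5*n))
      (side_weight B (E - B) (exch_nbrs E indep B))"
  let ?Y = "\<lambda>B. expectation_on E {..<5*n} (\<lambda>_ _. 1 / real (5*n))
      (side_weight (E - B) B (exch_nbrs E indep B))"
  have pos: "0 \<le> expectation_on E {..<5*n} (\<lambda>_ _. 1 / real (5*n)) (side_weight P Q nb)"
    for P Q :: "'a set" and nb
    unfolding expectation_on_def side_weight_def
    by (intro sum_nonneg mult_nonneg_nonneg prod_nonneg ballI add_nonneg_nonneg) auto
  have XY: "1 \<le> ?X B * ?Y B" if B: "B \<in> ?\<B>" for B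
  proof -
    have eq: "B \<union> (E - B) = E" using B basis_subset by blast
    have bip: "bipartite_with_leaves B (E - B) (exch_leaves B) (exch_nbrs E indep B)"
      by (rule exch_graph_bipartite) (use B assms(2,3) in auto)
    show ?thesis
      by (rule expectation_side_weight_product[OF bip n, unfolded eq]) (use ge in auto)
  qed
  \<comment> \<open>At (1, 1) every activity product is 1, so the expansion counts the
    bases.\<close>
  obtain t :: "'a \<Rightarrow> nat" where "inj_on t E" using refine_to_injective[of "\<lambda>_. 0"] by blast
  then have "(tutte E indep 1 1)\<^sup>2 = (real (card ?\<B>))\<^sup>2" by (simp add: tutte_activities)
  also have "\<dots> \<le> (\<Sum>B\<in>?\<B>. ?X B) * (\<Sum>B\<in>?\<B>. ?Y B)"
    by (rule sum_mult_sum_ge_card_square[OF finite_bases pos pos XY])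
  also have "\<dots> \<le> tutte E indep a 0 * tutte E indep 0 a"
    by (rule mult_mono[OF expectation_side_weight_le_tutte[OF a n]
      order_trans[OF sum_nonneg[OF pos] expectation_side_weight_le_tutte(1)[OF a n]] sum_nonneg[OF pos]])
  finally show ?thesis .
qed

end
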